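(* Assume that $\alpha\to\infty$, $\beta\to\infty$ and $\alpha/\beta\to c$ for some $c\in(0,\infty)$. Let $Q_{\alpha,\beta}$ be the distribution of $\mathbb{Z}_{\alpha,\beta}$ on $\triangle_\infty$. Then the family $\{Q_{\alpha,\beta}:\alpha>0,\beta>0\}$ satisfies a large deviation principle on the space $\triangle_\infty$ with speed $\gamma=\max\{\alpha,\beta\}$ and good rate function $$I(\mathbf{z})=\sup_{m\ge1}I_m(z_1,\ldots,z_m),\qquad \mathbf{z}=(z_1,z_2,\ldots)\in\triangle_\infty,$$ where $$I_m(z_1,\ldots,z_m)=\inf\left\{\sum_{i=1}^m\left(a\log\frac{1}{1-u_i}+b\prod_{j=1}^{i-1}(1-u_j)\,h(u_i,w_i)\right)\right\},$$ the infimum being taken over all $u_1,\ldots,u_m,w_1,\ldots,w_m\in E$ with $u_i<1$ for all $i$ and $$\left(w_1,\ (1-w_1)w_2,\ \ldots,\ (1-w_1)\cdots(1-w_{m-1})w_m\right)=(z_1,\ldots,z_m).$$ Here $$h(u,w)=u\log\frac{u}{w}+(1-u)\log\frac{1-u}{1-w},$$ $\prod_{j=1}^{i-1}(1-u_j)=1$ for $i=1$, and the coefficients are $(a,b)=(c,1)$ if $c<1$, $(a,b)=(1,c^{-1})$ if $c>1$, and $(a,b)=(1,1)$ if $c=1$.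
   Context: $E=[0,1]$. $\triangle_\infty=\{\mathbf{p}=(p_1,p_2,\ldots)\in E^\infty:\sum_{i=1}^\infty p_i\le1\}$, with the subspace topology of the product topology on $E^\infty$, generated by the metric $d(\mathbf{u},\mathbf{v})=\sum_{i=1}^\infty 2^{-i}(|u_i-v_i|\wedge1)$. For $\alpha,\beta>0$, let $U_1,U_2,\ldots$ be i.i.d. with the Beta$(1,\alpha)$ distribution; set $V_1=U_1$, $V_n=(1-U_1)\cdots(1-U_{n-1})U_n$ for $n\ge2$, and $\mathbb{V}_\alpha=(V_1,V_2,\ldots)$. Given $\mathbb{V}_\alpha$, let $W_1,W_2,\ldots$ be conditionally independent, $W_n$ having the Beta$\left(\beta V_n,\ \beta(1-\sum_{k=1}^nV_k)\right)$ distribution. Set $Z_1=W_1$, $Z_n=(1-W_1)\cdots(1-W_{n-1})W_n$ for $n\ge2$, and $\mathbb{Z}_{\alpha,\beta}=(Z_1,Z_2,\ldots)$. Conventions for $h$ on the boundary: $0\log\frac{0}{y}=0$ for all $y\in[0,1]$, and $x\log\frac{x}{0}=+\infty$ for $x>0$ (so $h$ takes values in $[0,+\infty]$). Large deviation principle: a family $\{P_\lambda\}$ of probability measures on a Polish space $S$ satisfies a large deviation principle with speed $a(\lambda)\to\infty$ and good rate function $I:S\to[0,\infty]$ if $\{s\in S:I(s)\le r\}$ is compact for every finite $r\ge0$ and, for every measurable $G\subset S$ with interior $G^\circ$ and closure $\bar G$, $$-\inf_{s\in G^\circ}I(s)\le\liminf\frac{1}{a(\lambda)}\log P_\lambda(G)\le\limsup\frac{1}{a(\lambda)}\log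 P_\lambda(G)\le-\inf_{s\in\bar G}I(s).$$ Here the index is $\lambda=(\alpha,\beta)$, and the limits are taken along the limiting procedure $\alpha\to\infty$, $\beta\to\infty$, $\alpha/\beta\to c$ (i.e. along any sequence of pairs $(\alpha,\beta)$ with these properties). *)

theory Defs
  imports "HOL-Probability.Probability"
begin

text \<open>Sequences \<open>(x\<^sub>1, x\<^sub>2, \<dots>)\<close> are functions on \<open>nat\<close>, indexed from 0: the coordinate
  \<open>x\<^sub>n\<close> of the mathematics is \<open>x (n - 1)\<close>. The library topology on \<open>nat \<Rightarrow> real\<close> is the
  product topology.\<close>

section \<open>Large deviation principles\<close>

definition ereal_log :: "real \<Rightarrow> ereal" where
  "ereal_log p = (if p = 0 then -\<infinity> else ereal (ln p))"

text \<open>The probability measures \<open>P i\<close> live on the subspace \<open>S\<close>, and limits are taken along the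
  filter \<open>F\<close>. Interior and closure are relative to \<open>S\<close>. An infimum over the empty
  set is \<open>\<infinity>\<close>.\<close>

definition good_rate_function :: "'a::topological_space set \<Rightarrow> ('a \<Rightarrow> ereal) \<Rightarrow> bool" where
  "good_rate_function S I \<longleftrightarrow>
     (\<forall>s\<in>S. 0 \<le> I s) \<and> (\<forall>r\<ge>0. compact {s \<in> S. I s \<le> ereal r})"

definition satisfies_LDP ::
  "'a::topological_space set \<Rightarrow> 'i filter \<Rightarrow> ('i \<Rightarrow> 'a measure) \<Rightarrow> ('i \<Rightarrow> real) \<Rightarrow> ('a \<Rightarrow> ereal) \<Rightarrow> bool"
where
  "satisfies_LDP S F P a I \<longleftrightarrow>
     (\<forall>i. prob_space (P i) \<and> space (P i) = S \<and> sets (P i) = sets (restrict_space borel S)) \<and>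
     filterlim a at_top F \<and>
     good_rate_function S I \<and>
     (\<forall>G \<in> sets (restrict_space borel S).
        - (INF s \<in> top_of_set S interior_of G. I s)
          \<le> Liminf F (\<lambda>i. ereal (1 / a i) * ereal_log (measure (P i) G)) \<and>
        Liminf F (\<lambda>i. ereal (1 / a i) * ereal_log (measure (P i) G))
          \<le> Limsup F (\<lambda>i. ereal (1 / a i) * ereal_log (measure (P i) G)) \<and>
        Limsup F (\<lambda>i. ereal (1 / a i) * ereal_log (measure (P i) G))
          \<le> - (INF s \<in> top_of_set S closure_of G. I s))"

section \<open>The random sequences\<close>

definition infinite_simplex :: "(nat \<Rightarrow> real) set" where
  "infinite_simplex = {p. (\<forall>i. p i \<in> {0..1}) \<and> summable p \<and> (\<Sum>i. p i) \<le> 1}"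

definition stick_breaking :: "(nat \<Rightarrow> real) \<Rightarrow> nat \<Rightarrow> real" where
  "stick_breaking u n = (\<Prod>k<n. 1 - u k) * u n"

text \<open>The Beta distribution. The first two branches are the weak limits at the boundary of the
  parameter range; below they are only met on null sets and serve to make the map total.\<close>

definition beta_distribution :: "real \<Rightarrow> real \<Rightarrow> real measure" where
  "beta_distribution a b =
     (if a \<le> 0 then return borel 0
      else if b \<le> 0 then return borel 1
      else density lborel (\<lambda>x. ennreal
             (if 0 < x \<and> x < 1 then x powr (a - 1) * (1 - x) powr (b - 1) / Beta a b else 0)))"

text \<open>The law of \<open>\<bbbV>\<^sub>\<alpha>\<close>.\<close>

definition V_law :: "real \<Rightarrow> (nat \<Rightarrow> real) measure" where
  "V_law \<alpha> = distr (Pi\<^sub>M UNIV (\<lambda>_. beta_distribution 1 \<alpha>)) borel stick_breaking"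

text \<open>The conditional law of \<open>(W\<^sub>1, W\<^sub>2, \<dots>)\<close> given \<open>\<bbbV>\<^sub>\<alpha> = v\<close>.\<close>

definition W_kernel :: "real \<Rightarrow> (nat \<Rightarrow> real) \<Rightarrow> (nat \<Rightarrow> real) measure" where
  "W_kernel \<beta> v =
     Pi\<^sub>M UNIV (\<lambda>n. beta_distribution (\<beta> * v n) (\<beta> * (1 - (\<Sum>k\<le>n. v k))))"

text \<open>The law of \<open>\<bbbZ>\<^sub>\<alpha>\<^sub>,\<^sub>\<beta>\<close>. On all of \<open>nat \<Rightarrow> real\<close> it is concentrated on the
  simplex, to which it is then restricted.\<close>

definition Q_law :: "real \<Rightarrow> real \<Rightarrow> (nat \<Rightarrow> real) measure" where
  "Q_law \<alpha> \<beta> = restrict_space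
     (V_law \<alpha> \<bind> (\<lambda>v. distr (W_kernel \<beta> v) borel stick_breaking)) infinite_simplex"

section \<open>The rate function\<close>

text \<open>\<open>x log (x / y)\<close> with \<open>0 log (0 / y) = 0\<close> and \<open>x log (x / 0) = \<infinity>\<close> for \<open>x > 0\<close>.\<close>

definition xlog :: "real \<Rightarrow> real \<Rightarrow> ereal" where
  "xlog x y = (if x = 0 then 0 else if y = 0 then \<infinity> else ereal (x * ln (x / y)))"

definition h :: "real \<Rightarrow> real \<Rightarrow> ereal" where
  "h u w = xlog u w + xlog (1 - u) (1 - w)"

definition coeff_a :: "real \<Rightarrow> real" where
  "coeff_a c = (if c < 1 then c else 1)"

definition coeff_b :: "real \<Rightarrow> real" where
  "coeff_b c = (if c > 1 then 1 / c else 1)"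

text \<open>Only the first \<open>m\<close> coordinates of \<open>u\<close>, \<open>w\<close> and \<open>z\<close> matter.\<close>

definition rate_m :: "real \<Rightarrow> nat \<Rightarrow> (nat \<Rightarrow> real) \<Rightarrow> ereal" where
  "rate_m c m z = Inf {(\<Sum>i<m. ereal (coeff_a c * ln (1 / (1 - u i)))
                            + ereal (coeff_b c * (\<Prod>j<i. 1 - u j)) * h (u i) (w i)) | u w.
      (\<forall>i<m. 0 \<le> u i \<and> u i < 1 \<and> 0 \<le> w i \<and> w i \<le> 1) \<and>
      (\<forall>i<m. stick_breaking w i = z i)}"

definition rate :: "real \<Rightarrow> (nat \<Rightarrow> real) \<Rightarrow> ereal" where
  "rate c z = (SUP m\<in>{1..}. rate_m c m z)"

end

theory Submission
  imports Defs "HOL-Real_Asymp.Real_Asymp"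
begin

text \<open>
  The simplex is compact, so the large deviation principle reduces to bounds near single points
  \<open>z\<close>, and only finitely many coordinates of \<open>(u, w)\<close> are involved at a time. Given
  \<open>u\<close>, the variables \<open>W\<^sub>i\<close> are independent Beta variables with parameters
  \<open>N u\<^sub>i, N (1 - u\<^sub>i)\<close> for \<open>N = \<beta> (1 - u\<^sub>1) \<cdots> (1 - u\<^bsub>i-1\<^esub>)\<close>. A Chernoff bound for the
  Beta distribution has the exact exponent \<open>N h (u\<^sub>i, w\<^sub>i)\<close> with no polynomial correction, so it
  remains valid when the parameters are small; conversely the Beta density, estimated from below
  at interior points, yields the matching lower bound. The variables \<open>U\<^sub>i\<close> have explicit tails
  \<open>(1 - x) powr \<alpha>\<close>. Minimising the total exponent over the fibre of the stick-breaking map above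
  \<open>z\<close> gives the rate function, by compactness of the fibre for the upper bound and by moving
  \<open>(u, w)\<close> into the interior of the cube for the lower bound.
\<close>

section \<open>Local criterion for a large deviation principle\<close>

text \<open>The obstacle is the boundary of the cube, where \<open>h\<close> can jump to infinity
  and so cannot be bounded locally by continuity. The upper bound uses a dual form of
  \<open>h\<close> instead: for a fixed pair \<open>P\<close>, \<open>Q\<close> the constraint
  \<open>w * P + (1 - w) * Q < 1\<close> is open in \<open>w\<close>, and the exponent
  \<open>u * ln P + (1 - u) * ln Q\<close> is continuous in \<open>u\<close>. A bound found at one
  point thus holds on a neighbourhood with the same pair, even where \<open>h\<close> is infinite.
  Points with some \<open>u i = 1\<close> are excluded from the infimum but needed for compactness;
  near them the tail of the Beta(1, \<alpha>) law alone yields every exponent. The lower bound needs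
  large Beta parameters, and these are available uniformly near a fixed interior \<open>u\<close>
  once \<beta> is large. The supremum over \<open>m\<close> fits both halves:
  \<open>r < rate c z\<close> is witnessed by a single \<open>m\<close>, while an open set around
  \<open>z\<close> contains a cylinder that depends on finitely many coordinates.\<close>

lemma exponential_rate_Limsup_le:
  fixes p a :: "nat \<Rightarrow> real"
  assumes a: "filterlim a at_top sequentially" and p: "\<And>n. 0 \<le> p n"
    and bd: "\<forall>\<^sub>F n in sequentially. p n \<le> C * exp (- a n * r)"
  shows "Limsup sequentially (\<lambda>n. ereal (1 / a n) * ereal_log (p n)) \<le> ereal (- r)"
proof (rule ereal_le_epsilon2)
  fix e :: real assume e: "e > 0"
  \<comment> \<open>Nothing is assumed about the sign of \<open>C\<close>; enlarging it to at least
    1 gives a nonnegative logarithm, which \<open>e * a n\<close> eventually absorbs.\<close>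
  define C' where "C' = max C 1"
  have C': "C' > 0" "C \<le> C'" by (auto simp: C'_def)
  have "\<forall>\<^sub>F n in sequentially. a n > max 1 (ln C' / e)"
    using filterlim_at_top_dense[THEN iffD1, OF a] by blast
  with bd have "\<forall>\<^sub>F n in sequentially. ereal (1 / a n) * ereal_log (p n) \<le> ereal (- r) + ereal e"
  proof eventually_elim
    case (elim n)
    have an: "a n > 0" and le: "ln C' \<le> e * a n" using elim e by (auto simp: field_simps)
    show ?case
    proof (cases "p n = 0")
      case True
      then show ?thesis using an by (simp add: ereal_log_def)
    next
      case False
      then have pos: "0 < p n" using p[of n] by simp
      have "p n \<le> C' * exp (- a n * r)"
        using elim(1) C'(2) by (meson exp_ge_zero mult_right_mono order_trans)
      then have "ln (p n) \<le> ln (C' * exp (- a n * r))"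
        using pos by (metis ln_mono)
      also have "\<dots> = ln C' - a n * r" using C' by (simp add: ln_mult)
      also have "\<dots> \<le> e * a n - a n * r" using le by simp
      finally have "ln (p n) / a n \<le> e - r" using an by (simp add: field_simps)
      then show ?thesis using False by (simp add: ereal_log_def)
    qed
  qed
  then show "Limsup sequentially (\<lambda>n. ereal (1 / a n) * ereal_log (p n)) \<le> ereal (- r) + ereal e"
    by (rule Limsup_bounded)
qed

lemma exponential_rate_Liminf_ge:
  fixes p a :: "nat \<Rightarrow> real"
  assumes a: "filterlim a at_top sequentially"
    and bd: "\<forall>\<^sub>F n in sequentially. exp (- a n * r) \<le> p n"
  shows "ereal (- r) \<le> Liminf sequentially (\<lambda>n. ereal (1 / a n) * ereal_log (p n))"
proof (rule Liminf_bounded)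
  have "\<forall>\<^sub>F n in sequentially. a n > 0"
    using filterlim_at_top_dense[THEN iffD1, OF a] by blast
  with bd show "\<forall>\<^sub>F n in sequentially. ereal (- r) \<le> ereal (1 / a n) * ereal_log (p n)"
  proof eventually_elim
    case (elim n)
    then have pos: "0 < p n" by (meson exp_gt_zero less_le_trans)
    have "- a n * r \<le> ln (p n)" using elim(1) pos by (simp add: ln_ge_iff)
    then have "- r \<le> ln (p n) / a n" using elim(2) by (simp add: field_simps)
    then show ?case using pos by (simp add: ereal_log_def)
  qed
qed

text \<open>On a compact space an LDP is a local property. Lower semicontinuity and nonnegativity of the
  rate function need no separate argument: they follow by comparing the two local bounds.\<close>

lemma satisfies_LDP_local:
  fixes S :: "'a::t2_space set" and P :: "nat \<Rightarrow> 'a measure"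
  assumes S: "compact S" and P: "\<And>n. prob_space (P n)" "\<And>n. space (P n) = S"
      "\<And>n. sets (P n) = sets (restrict_space borel S)"
    and a: "filterlim a at_top sequentially"
    and L: "\<And>z G r. \<lbrakk>z \<in> S; open G; z \<in> G; I z < ereal r\<rbrakk> \<Longrightarrow>
        \<forall>\<^sub>F n in sequentially. exp (- a n * r) \<le> measure (P n) (G \<inter> S)"
    and U: "\<And>z r. \<lbrakk>z \<in> S; ereal r < I z\<rbrakk> \<Longrightarrow>
        \<exists>N C. open N \<and> z \<in> N \<and>
          (\<forall>\<^sub>F n in sequentially. measure (P n) (N \<inter> S) \<le> C * exp (- a n * r))"
  shows "satisfies_LDP S sequentially P a I"
proof -
  have opn: "N \<inter> S \<in> sets (P n)" if "open N" for N n
    using that unfolding P(3) sets_restrict_space by (auto simp: Int_commute)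
  have le1: "measure (P n) A \<le> 1" for n A
    using prob_space.prob_le_1[OF P(1)] .
  have nonneg: "0 \<le> I z" if z: "z \<in> S" for z
  proof (rule ccontr)
    assume "\<not> 0 \<le> I z"
    then obtain r where r: "I z < ereal r" "r < 0"
      by (metis ereal_dense2 ereal_less(1) linorder_not_le zero_ereal_def less_ereal.simps(1))
    \<comment> \<open>A negative rate would force the total mass to exceed 1.\<close>
    have "\<forall>\<^sub>F n in sequentially. exp (- a n * r) \<le> measure (P n) (UNIV \<inter> S)"
      by (rule L[OF z _ _ r(1)]) auto
    moreover have "\<forall>\<^sub>F n in sequentially. a n > 0" using filterlim_at_top_dense[THEN iffD1, OF a] by blast
    ultimately have "\<forall>\<^sub>F n in sequentially. False"
    proof eventually_elim
      case (elim n)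
      have "- a n * r > 0" using elim r by (simp add: mult_neg_neg mult_pos_neg)
      then have "1 < exp (- a n * r)" by simp
      then show False using elim le1[of n "UNIV \<inter> S"] by linarith
    qed
    then show False by simp
  qed
  have lsc: "\<exists>N. open N \<and> z \<in> N \<and> N \<inter> {s \<in> S. I s \<le> ereal r} = {}"
    if z: "z \<in> S" "\<not> I z \<le> ereal r" for z r
  proof -
    obtain r2 where r2: "ereal r < ereal r2" "ereal r2 < I z"
      using z(2) ereal_dense2 not_le by metis
    obtain r1 where r1: "r < r1" "r1 < r2" using r2(1) dense by auto
    obtain N C where N: "open N" "z \<in> N"
      "\<forall>\<^sub>F n in sequentially. measure (P n) (N \<inter> S) \<le> C * exp (- a n * r2)"
      using U[OF z(1) r2(2)] by blast
    \<comment> \<open>A point \<open>s\<close> of the sublevel set inside \<open>N\<close> would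
      satisfy the lower bound at level \<open>r1\<close> on the very set that obeys the upper bound
      at level \<open>r2 > r1\<close>; no constant \<open>C\<close> can reconcile the two.\<close>
    have False if s: "s \<in> N" "s \<in> S" "I s \<le> ereal r" for s
    proof -
      have "\<forall>\<^sub>F n in sequentially. exp (- a n * r1) \<le> measure (P n) (N \<inter> S)"
        using L[OF s(2) N(1) s(1), of r1] s(3) r1 by (simp add: order.strict_trans1)
      moreover have "\<forall>\<^sub>F n in sequentially. a n > max 0 (ln (max C 1) / (r2 - r1))"
        using filterlim_at_top_dense[THEN iffD1, OF a] by blast
      ultimately have "\<forall>\<^sub>F n in sequentially. False"
        using N(3)
      proof eventually_elim
        case (elim n)
        have "ln (max C 1) < a n * (r2 - r1)" using elim(2) r1 by (auto simp: field_simps)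
        then have "max C 1 < exp (a n * (r2 - r1))"
          by (metis exp_less_cancel_iff exp_ln less_max_iff_disj zero_less_one)
        moreover have "exp (- a n * r1) \<le> max C 1 * exp (- a n * r2)"
          by (rule order_trans[OF order_trans[OF elim(1) elim(3)]]) (simp add: mult_right_mono)
        then have "exp (- a n * r1) * exp (a n * r2) \<le> max C 1"
          by (simp add: exp_minus field_simps)
        then have "exp (a n * (r2 - r1)) \<le> max C 1"
          by (simp add: exp_add[symmetric] algebra_simps)
        ultimately show False by linarith
      qed
      then show False by simp
    qed
    then show ?thesis using N by blast
  qed
  have cpt: "compact {s \<in> S. I s \<le> ereal r}" for r
  proof -
    define O' where "O' = \<Union>{N. open N \<and> N \<inter> {s \<in> S. I s \<le> ereal r} = {}}"
    have "open O'" by (auto simp: O'_def)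
    moreover have "{s \<in> S. I s \<le> ereal r} = S - O'"
      using lsc[of _ r] by (auto simp: O'_def)
    ultimately show ?thesis using S by (simp add: compact_diff)
  qed
  have lower: "- (INF s \<in> top_of_set S interior_of G. I s)
      \<le> Liminf sequentially (\<lambda>n. ereal (1 / a n) * ereal_log (measure (P n) G))"
    if G: "G \<in> sets (restrict_space borel S)" for G
  proof -
    have "- Liminf sequentially (\<lambda>n. ereal (1 / a n) * ereal_log (measure (P n) G))
      \<le> (INF s \<in> top_of_set S interior_of G. I s)"
    proof (rule INF_greatest)
      fix z assume z: "z \<in> top_of_set S interior_of G"
      have "openin (top_of_set S) (top_of_set S interior_of G)" by simp
      then obtain N where N: "open N" "top_of_set S interior_of G = S \<inter> N"
        unfolding openin_open by blast
      have sub: "N \<inter> S \<subseteq> G" using N(2) interior_of_subset[of "top_of_set S" G] by auto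
      show "- Liminf sequentially (\<lambda>n. ereal (1 / a n) * ereal_log (measure (P n) G)) \<le> I z"
      proof (rule ereal_le_real)
        fix r assume "I z \<le> ereal r"
        show "- Liminf sequentially (\<lambda>n. ereal (1 / a n) * ereal_log (measure (P n) G)) \<le> ereal r"
        proof (rule ereal_le_epsilon2)
          fix e :: real assume "e > 0"
          then have "I z < ereal (r + e)" using \<open>I z \<le> ereal r\<close>
            by (metis ereal_less_eq(3) less_add_same_cancel1 not_le order_trans)
          then have "\<forall>\<^sub>F n in sequentially. exp (- a n * (r + e)) \<le> measure (P n) (N \<inter> S)"
            using L[OF _ N(1)] z N(2) by auto
          then have "\<forall>\<^sub>F n in sequentially. exp (- a n * (r + e)) \<le> measure (P n) G"
          proof eventually_elim
            case (elim n)
            interpret prob_space "P n" by (rule P)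
            have "measure (P n) (N \<inter> S) \<le> measure (P n) G"
              using sub G P(3) by (intro finite_measure_mono) auto
            then show ?case using elim by linarith
          qed
          from exponential_rate_Liminf_ge[OF a this]
          show "- Liminf sequentially (\<lambda>n. ereal (1 / a n) * ereal_log (measure (P n) G)) \<le> ereal r + ereal e"
            by (simp add: ereal_uminus_le_reorder)
        qed
      qed
    qed
    then show ?thesis by (simp add: ereal_uminus_le_reorder)
  qed
  have upper: "Limsup sequentially (\<lambda>n. ereal (1 / a n) * ereal_log (measure (P n) G))
      \<le> - (INF s \<in> top_of_set S closure_of G. I s)"
    if G: "G \<in> sets (restrict_space borel S)" for G
  proof -
    let ?F = "top_of_set S closure_of G"
    let ?L = "Limsup sequentially (\<lambda>n. ereal (1 / a n) * ereal_log (measure (P n) G))"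
    have GS: "G \<subseteq> S" using G by (auto simp: sets_restrict_space)
    have Fsub: "?F \<subseteq> S" "G \<subseteq> ?F"
      using closure_of_subset_topspace[of "top_of_set S" G] closure_of_subset[of G "top_of_set S"] GS
      by auto
    have "closedin (top_of_set S) ?F" by simp
    then have cF: "compact ?F" using S by (meson closedin_compact)
    have key: "?L \<le> ereal (- r)" if r: "ereal r < (INF s \<in> ?F. I s)" for r
    proof -
      have "\<forall>z\<in>?F. \<exists>N C. open N \<and> z \<in> N \<and>
          (\<forall>\<^sub>F n in sequentially. measure (P n) (N \<inter> S) \<le> C * exp (- a n * r))"
      proof
        fix z assume z: "z \<in> ?F"
        have "ereal r < I z" using r z by (meson INF_lower order.strict_trans2)
        then show "\<exists>N C. open N \<and> z \<in> N \<and>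
          (\<forall>\<^sub>F n in sequentially. measure (P n) (N \<inter> S) \<le> C * exp (- a n * r))"
          using U z Fsub by blast
      qed
      then obtain N C where NC: "\<And>z. z \<in> ?F \<Longrightarrow> open (N z) \<and> z \<in> N z \<and>
          (\<forall>\<^sub>F n in sequentially. measure (P n) (N z \<inter> S) \<le> C z * exp (- a n * r))"
        by metis
      obtain D where D: "D \<subseteq> ?F" "finite D" "?F \<subseteq> (\<Union>z\<in>D. N z)"
        by (rule compactE_image[OF cF, of ?F N]) (use NC in auto)
      have "\<forall>\<^sub>F n in sequentially. \<forall>z\<in>D. measure (P n) (N z \<inter> S) \<le> C z * exp (- a n * r)"
        using D NC by (intro eventually_ball_finite) auto
      \<comment> \<open>The finite cover only adds up the constants, which do not affect the
        exponential rate.\<close>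
      then have "\<forall>\<^sub>F n in sequentially. measure (P n) G \<le> (\<Sum>z\<in>D. C z) * exp (- a n * r)"
      proof eventually_elim
        case (elim n)
        interpret prob_space "P n" by (rule P)
        have opD: "\<And>z. z \<in> D \<Longrightarrow> N z \<inter> S \<in> sets (P n)" using D NC opn by blast
        have "measure (P n) G \<le> measure (P n) (\<Union>z\<in>D. N z \<inter> S)"
          using D Fsub GS by (intro finite_measure_mono sets.finite_UN opD) auto
        also have "\<dots> \<le> (\<Sum>z\<in>D. measure (P n) (N z \<inter> S))"
          using D opD by (intro finite_measure_subadditive_finite) auto
        also have "\<dots> \<le> (\<Sum>z\<in>D. C z * exp (- a n * r))" using elim by (intro sum_mono) auto
        finally show ?case by (simp add: sum_distrib_right)
      qed
      then show ?thesis by (intro exponential_rate_Limsup_le[OF a]) auto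
    qed
    have "(INF s \<in> ?F. I s) \<le> - ?L"
    proof (rule dense_le)
      fix y assume y: "y < (INF s \<in> ?F. I s)"
      show "y \<le> - ?L"
      proof (cases y)
        case (real r)
        then show ?thesis using key[of r] y by (metis ereal_uminus_le_reorder ereal_uminus_uminus uminus_ereal.simps(1))
      qed (use y in auto)
    qed
    then show ?thesis by (metis ereal_uminus_le_reorder ereal_uminus_uminus)
  qed
  show ?thesis
    unfolding satisfies_LDP_def good_rate_function_def
    using P a nonneg cpt lower upper by (auto intro!: Liminf_le_Limsup)
qed

section \<open>Estimates for the Beta distribution\<close>

lemma nn_integral_beta_kernel:
  assumes "0 < A" "0 < B"
  shows "(\<integral>\<^sup>+x. ennreal (x powr (A - 1) * (1 - x) powr (B - 1)) * indicator {0..1} x \<partial>lborel) = ennreal (Beta A B)"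
proof -
  have "integral\<^sup>N lborel (\<lambda>x. indicator {0..1} x * (x powr (A - 1) * (1 - x) powr (B - 1))) = Beta A B"
    using has_integral_Beta_real[OF assms] by (intro nn_integral_has_integral_lebesgue) auto
  then show ?thesis
    by (simp add: ennreal_mult'' ennreal_indicator mult.commute cong: nn_integral_cong)
qed

lemma Beta_pos: "0 < A \<Longrightarrow> 0 < B \<Longrightarrow> 0 < Beta A (B::real)"
  by (simp add: Beta_def)

lemma sets_beta_distribution [simp, measurable_cong]: "sets (beta_distribution A B) = sets borel"
  by (simp add: beta_distribution_def)

lemma space_beta_distribution [simp]: "space (beta_distribution A B) = UNIV"
  by (simp add: beta_distribution_def)

text \<open>The closed interval matches the form of the Beta integral. The endpoints agree exactly
  and not just almost everywhere, because \<open>0 powr y = 0\<close> for every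
  \<open>y\<close>.\<close>

lemma emeasure_beta_distribution:
  assumes "0 < A" "0 < B" "X \<in> sets borel"
  shows "emeasure (beta_distribution A B) X =
    (\<integral>\<^sup>+x. ennreal (x powr (A - 1) * (1 - x) powr (B - 1) / Beta A B) * indicator {0..1} x * indicator X x \<partial>lborel)"
proof -
  have [measurable]: "X \<in> sets borel" by fact
  have "emeasure (beta_distribution A B) X = (\<integral>\<^sup>+x. ennreal
             (if 0 < x \<and> x < 1 then x powr (A - 1) * (1 - x) powr (B - 1) / Beta A B else 0) * indicator X x \<partial>lborel)"
    using assms by (simp add: beta_distribution_def emeasure_density)
  also have "\<dots> = (\<integral>\<^sup>+x. ennreal (x powr (A - 1) * (1 - x) powr (B - 1) / Beta A B) * indicator {0..1} x * indicator X x \<partial>lborel)"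
    by (intro nn_integral_cong) (auto simp: indicator_def)
  finally show ?thesis .
qed

lemma prob_space_beta_distribution: "prob_space (beta_distribution A B)"
proof (cases "0 < A \<and> 0 < B")
  case True
  have "emeasure (beta_distribution A B) UNIV
     = (\<integral>\<^sup>+x. ennreal (1 / Beta A B) * (ennreal (x powr (A - 1) * (1 - x) powr (B - 1)) * indicator {0..1} x) \<partial>lborel)"
    using True Beta_pos[of A B]
    by (subst emeasure_beta_distribution) (auto intro!: nn_integral_cong simp: ennreal_mult'[symmetric] indicator_def)
  also have "\<dots> = ennreal (1 / Beta A B) * ennreal (Beta A B)"
    using True by (subst nn_integral_cmult) (auto simp: nn_integral_beta_kernel)
  also have "\<dots> = 1" using True Beta_pos[of A B] by (simp add: ennreal_mult'[symmetric])
  finally show ?thesis by (intro prob_spaceI) simp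
qed (auto simp: beta_distribution_def intro!: prob_space_return)

lemma AE_beta_distribution: "AE x in beta_distribution A B. x \<in> {0..1}"
proof -
  have "AE x in density lborel (\<lambda>x. ennreal
             (if 0 < x \<and> x < 1 then x powr (A - 1) * (1 - x) powr (B - 1) / Beta A B else 0)). x \<in> {0..1}"
    by (subst AE_density) (auto intro!: AE_I2)
  moreover have "AE x in return borel (0::real). x \<in> {0..1}" "AE x in return borel (1::real). x \<in> {0..1}"
    by (subst AE_return; auto)+
  ultimately show ?thesis unfolding beta_distribution_def by auto
qed

lemma AE_beta_distribution_interior:
  assumes "0 < A" "0 < B"
  shows "AE x in beta_distribution A B. x \<in> {0<..<1}"
  using assms unfolding beta_distribution_def
  by (simp add: AE_density)

text \<open>The substitution \<open>y = x P / (x P + (1 - x) Q)\<close> evaluates the integral of the Beta kernel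
  against \<open>(x P + (1 - x) Q) powr - (A + B)\<close>, a factor that is at least 1 on \<open>X\<close>.\<close>

lemma beta_distribution_chernoff:
  assumes AB: "0 < A" "0 < B" and PQ: "0 < P" "0 < Q" and X: "X \<in> sets borel"
    and le: "\<And>x. x \<in> X \<Longrightarrow> 0 < x \<Longrightarrow> x < 1 \<Longrightarrow> x * P + (1 - x) * Q \<le> 1"
  shows "measure (beta_distribution A B) X \<le> P powr - A * Q powr - B"
proof -
  interpret prob_space "beta_distribution A B" by (rule prob_space_beta_distribution)
  define D where "D x = x * P + (1 - x) * Q" for x
  \<comment> \<open>\<open>g\<close> is the fractional linear map fixing 0 and 1, and
    \<open>g'\<close> below is its derivative.\<close>
  define g where "g x = x * P / D x" for x
  define g' where "g' x = P * Q / (D x)^2" for x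
  define k where "k x = x powr (A - 1) * (1 - x) powr (B - 1)" for x
  have Beta: "Beta A B > 0" using AB by (rule Beta_pos)
  have D: "D x > 0" if "x \<in> {0..1}" for x
  proof (cases "x = 0")
    case True then show ?thesis using PQ by (simp add: D_def)
  next
    case False then show ?thesis using that PQ by (auto simp: D_def intro!: add_pos_nonneg)
  qed
  have km [measurable]: "k \<in> borel_measurable borel" unfolding k_def by measurable
  have "ennreal (Beta A B) = (\<integral>\<^sup>+x. ennreal (k x) * indicator {0..1} x \<partial>lborel)"
    unfolding k_def by (rule nn_integral_beta_kernel[OF AB, symmetric])
  also have "\<dots> = (\<integral>\<^sup>+x. ennreal (k x * indicator {g 0..g 1} x) \<partial>lborel)"
    using PQ by (intro nn_integral_cong) (auto simp: g_def D_def indicator_def)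
  also have "\<dots> = (\<integral>\<^sup>+x. ennreal (k (g x) * g' x * indicator {0..1} x) \<partial>lborel)"
  proof (rule nn_integral_substitution)
    show "set_borel_measurable borel {g 0..g 1} k"
      unfolding set_borel_measurable_def by measurable
    fix x :: real assume x: "x \<in> {0..1}"
    have "(D has_real_derivative P - Q) (at x)"
      unfolding D_def by (auto intro!: derivative_eq_intros)
    then have "(g has_real_derivative (P * D x - x * P * (P - Q)) / (D x * D x)) (at x)"
      unfolding g_def using D[OF x] by (auto intro!: derivative_eq_intros)
    also have "(P * D x - x * P * (P - Q)) / (D x * D x) = g' x"
      by (simp add: g'_def D_def power2_eq_square algebra_simps)
    finally show "(g has_real_derivative g' x) (at x)" .
    show "0 \<le> g' x" using PQ by (simp add: g'_def)
  next
    have "continuous_on {0..1} D" unfolding D_def by (intro continuous_intros)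
    then show "continuous_on {0..1} g'" unfolding g'_def
      by (intro continuous_intros) (use D in force)+
  qed simp
  finally have Beta_eq: "ennreal (Beta A B) = (\<integral>\<^sup>+x. ennreal (k (g x) * g' x * indicator {0..1} x) \<partial>lborel)" .
  \<comment> \<open>The substituted kernel is the original one times
    \<open>P powr A * Q powr B * D x powr - (A + B)\<close>, and \<open>D x \<le> 1\<close> on
    \<open>X\<close> makes the last factor at least 1.\<close>
  have pt: "k x \<le> P powr - A * Q powr - B * (k (g x) * g' x)" if x: "x \<in> {0..1}" "x \<in> X" for x
  proof (cases "x = 0 \<or> x = 1")
    case True then show ?thesis using PQ by (auto simp: k_def g'_def)
  next
    case False
    then have x': "0 < x" "x < 1" using x by auto
    have Dx: "0 < D x" "D x \<le> 1" using D[OF x(1)] le[OF x(2) x'] by (auto simp: D_def)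
    have 1: "1 - g x = (1 - x) * Q / D x" using Dx by (simp add: g_def D_def field_simps)
    have "P powr - A * Q powr - B * (k (g x) * g' x) = k x * D x powr - (A + B)"
    proof -
      \<comment> \<open>Naming \<open>1 - x\<close> keeps it an atom, so that the identity becomes
        linear in logarithms.\<close>
      define y where "y = 1 - x"
      have y: "0 < y" using x' by (simp add: y_def)
      have "ln (P powr - A * Q powr - B * (k (g x) * g' x)) = ln (k x * D x powr - (A + B))"
        unfolding k_def 1 unfolding g_def g'_def y_def[symmetric] using x' y PQ Dx
        by (simp add: ln_mult ln_div ln_powr ln_realpow algebra_simps)
      moreover have "0 < P powr - A * Q powr - B * (k (g x) * g' x)" "0 < k x * D x powr - (A + B)"
        unfolding k_def 1 unfolding g_def g'_def y_def[symmetric] using x' y PQ Dx by simp_all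
      ultimately show ?thesis by simp
    qed
    moreover have "1 \<le> D x powr - (A + B)"
      using Dx AB powr_le1[of "A + B" "D x"] by (simp add: powr_minus one_le_inverse del: minus_add_distrib)
    moreover have "0 \<le> k x" by (simp add: k_def)
    ultimately show ?thesis by (metis mult_left_mono mult.right_neutral)
  qed
  have "emeasure (beta_distribution A B) X \<le> (\<integral>\<^sup>+x. ennreal (P powr - A * Q powr - B / Beta A B) *
      ennreal (k (g x) * g' x * indicator {0..1} x) \<partial>lborel)"
    unfolding emeasure_beta_distribution[OF AB X] k_def[symmetric]
  proof (intro nn_integral_mono)
    fix x :: real
    show "ennreal (k x / Beta A B) * indicator {0..1} x * indicator X x
      \<le> ennreal (P powr - A * Q powr - B / Beta A B) * ennreal (k (g x) * g' x * indicator {0..1} x)"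
      using pt[of x] Beta
      by (auto simp: indicator_def ennreal_mult'[symmetric] divide_right_mono intro!: ennreal_leI)
  qed
  also have "\<dots> = ennreal (P powr - A * Q powr - B / Beta A B) * ennreal (Beta A B)"
  proof -
    have [measurable]: "D \<in> borel_measurable borel" unfolding D_def by measurable
    have [measurable]: "g \<in> borel_measurable borel" "g' \<in> borel_measurable borel"
      unfolding g_def g'_def by measurable
    show ?thesis unfolding Beta_eq by (rule nn_integral_cmult) measurable
  qed
  also have "\<dots> = ennreal (P powr - A * Q powr - B)"
    using Beta by (simp add: ennreal_mult'[symmetric])
  finally show ?thesis by (simp add: emeasure_eq_measure)
qed

text \<open>Gibbs' inequality: the likelihood is maximal at the mean \<open>u\<close>. With
  \<open>ln t \<le> t - 1\<close> at both ratios, the linear terms cancel because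
  \<open>A / u\<close> and \<open>B / (1 - u)\<close> both equal \<open>A + B\<close>.\<close>

lemma bernoulli_likelihood_le:
  assumes "0 < A" "0 < B" "0 < x" "x < 1" and u: "u = A / (A + B)"
  shows "x powr A * (1 - x) powr B \<le> u powr A * (1 - u) powr (B::real)"
proof -
  have u01: "0 < u" "u < 1" and Au: "A / u = A + B" "B / (1 - u) = A + B"
    using assms by (auto simp: u field_simps)
  have "A * ln (x / u) + B * ln ((1 - x) / (1 - u)) \<le> A * (x / u - 1) + B * ((1 - x) / (1 - u) - 1)"
    using assms u01 by (intro add_mono mult_left_mono ln_le_minus_one) auto
  also have "\<dots> = (A / u) * (x - u) + (B / (1 - u)) * (u - x)"
    using u01 by (simp add: field_simps)
  also have "\<dots> = 0" unfolding Au by (simp add: algebra_simps)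
  finally have "A * ln x + B * ln (1 - x) \<le> A * ln u + B * ln (1 - u)"
    using assms(3,4) u01 by (simp add: ln_div algebra_simps)
  then have "exp (A * ln x) * exp (B * ln (1 - x)) \<le> exp (A * ln u) * exp (B * ln (1 - u))"
    by (simp add: exp_add[symmetric])
  then show ?thesis using assms(3,4) u01 by (simp add: powr_def)
qed

text \<open>This replaces Stirling's formula. A fraction \<open>e\<close> of each exponent is set
  aside to absorb the \<open>- 1\<close>, leaving powers \<open>e * A - 1\<close> and
  \<open>e * B - 1\<close> that are nonnegative and hence give factors at most 1; the rest is
  bounded by its maximum at \<open>u\<close>. The loss \<open>1 - e\<close> disappears as
  \<open>e\<close> tends to 0.\<close>

lemma Beta_le:
  assumes AB: "0 < A" "0 < B" and e: "e < 1" "1 \<le> e * A" "1 \<le> e * B" and u: "u = A / (A + B)"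
  shows "Beta A (B::real) \<le> (u powr A * (1 - u) powr B) powr (1 - e)"
proof -
  let ?M = "(u powr A * (1 - u) powr B) powr (1 - e)"
  have "ennreal (Beta A B) \<le> (\<integral>\<^sup>+x. ennreal ?M * indicator {0..1::real} x \<partial>lborel)"
    unfolding nn_integral_beta_kernel[OF AB, symmetric]
  proof (intro nn_integral_mono)
    fix x :: real
    have "x powr (A - 1) * (1 - x) powr (B - 1) \<le> ?M" if x: "0 < x" "x < 1"
    proof -
      have "x powr (A - 1) * (1 - x) powr (B - 1)
        = (x powr A * (1 - x) powr B) powr (1 - e) * (x powr (e * A - 1) * (1 - x) powr (e * B - 1))"
        using x by (simp add: powr_def ln_mult exp_add[symmetric] algebra_simps)
      also have "\<dots> \<le> ?M * (1 * 1)"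
        using x e AB by (intro mult_mono powr_mono2 powr_le1 bernoulli_likelihood_le[OF AB x u]) auto
      finally show ?thesis by simp
    qed
    then show "ennreal (x powr (A - 1) * (1 - x) powr (B - 1)) * indicator {0..1} x \<le> ennreal ?M * indicator {0..1} x"
      by (cases "x = 0 \<or> x = 1") (auto simp: indicator_def intro!: ennreal_leI)
  qed
  also have "\<dots> = ennreal ?M" by (simp add: nn_integral_cmult_indicator)
  finally show ?thesis by (subst (asm) ennreal_le_iff) auto
qed

lemma beta_distribution_interval_ge:
  assumes AB: "0 < A" "0 < B" and e: "e < 1" "1 \<le> e * A" "1 \<le> e * B" and u: "u = A / (A + B)"
    and lk: "0 < l" "l < k" "k < 1"
  shows "(k - l) * (l powr A * (1 - k) powr B) / (u powr A * (1 - u) powr B) powr (1 - e)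
    \<le> measure (beta_distribution A B) {l<..<k}"
proof -
  interpret prob_space "beta_distribution A B" by (rule prob_space_beta_distribution)
  let ?c = "(l powr A * (1 - k) powr B) / (u powr A * (1 - u) powr B) powr (1 - e)"
  have Beta: "Beta A B > 0" using AB by (rule Beta_pos)
  have u01: "0 < u" "u < 1" using AB by (auto simp: u)
  have "ennreal (?c * (k - l)) = (\<integral>\<^sup>+x. ennreal ?c * indicator {l<..<k} x \<partial>lborel)"
    using lk by (simp add: nn_integral_cmult_indicator ennreal_mult'[symmetric])
  also have "\<dots> \<le> emeasure (beta_distribution A B) {l<..<k}"
    unfolding emeasure_beta_distribution[OF AB, of "{l<..<k}", simplified]
  proof (intro nn_integral_mono)
    fix x :: real
    have "?c \<le> x powr (A - 1) * (1 - x) powr (B - 1) / Beta A B" if x: "l < x" "x < k"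
    proof -
      have "l powr A * (1 - k) powr B \<le> x powr A * (1 - x) powr B"
        using x lk AB by (intro mult_mono powr_mono2) auto
      \<comment> \<open>Lowering the exponent of a base in (0, 1) increases the power, so the
        \<open>- 1\<close> is harmless in this direction.\<close>
      also have "\<dots> \<le> x powr (A - 1) * (1 - x) powr (B - 1)"
        using x lk by (intro mult_mono powr_mono') auto
      finally show ?thesis
        using Beta_le[OF AB e u] Beta by (intro frac_le) auto
    qed
    then show "ennreal ?c * indicator {l<..<k} x
      \<le> ennreal (x powr (A - 1) * (1 - x) powr (B - 1) / Beta A B) * indicator {0..1} x * indicator {l<..<k} x"
      using lk by (auto simp: indicator_def intro!: ennreal_leI)
  qed
  finally show ?thesis by (simp add: emeasure_eq_measure mult.commute)
qed

section \<open>Explicit tails of the Beta(1, \<alpha>) law\<close>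

lemma beta_distribution_1_greaterThan:
  assumes "0 < \<alpha>" "0 \<le> q" "q < 1"
  shows "measure (beta_distribution 1 \<alpha>) {q<..} = (1 - q) powr \<alpha>"
proof -
  interpret prob_space "beta_distribution 1 \<alpha>" by (rule prob_space_beta_distribution)
  have B: "Beta 1 \<alpha> = 1 / \<alpha>"
  proof -
    have "Gamma (1 + \<alpha>) = \<alpha> * Gamma \<alpha>"
      using assms Gamma_plus1[of \<alpha>] by (simp add: add.commute nonpos_Ints_def)
    then show ?thesis using assms Gamma_real_pos[of \<alpha>] by (simp add: Beta_def del: Gamma_real_pos)
  qed
  \<comment> \<open>The integrands differ at \<open>x = 0\<close>, where
    \<open>x powr (1 - 1)\<close> is 0 and not 1; hence the null set.\<close>
  have "emeasure (beta_distribution 1 \<alpha>) {..q} = (\<integral>\<^sup>+x. ennreal (\<alpha> * (1 - x) powr (\<alpha> - 1)) * indicator {0..q} x \<partial>lborel)"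
    using assms AE_lborel_singleton[of 0]
    by (subst emeasure_beta_distribution) (auto intro!: nn_integral_cong_AE elim!: eventually_mono simp: B indicator_def field_simps)
  also have "\<dots> = ennreal (- ((1 - q) powr \<alpha>) - - ((1 - 0) powr \<alpha>))"
    using assms by (intro nn_integral_FTC_Icc) (auto intro!: derivative_eq_intros)
  finally have "prob {..q} = 1 - (1 - q) powr \<alpha>"
    using assms by (simp add: emeasure_eq_measure powr_le1)
  moreover have "{q<..} = space (beta_distribution 1 \<alpha>) - {..q}" by auto
  ultimately show ?thesis by (simp add: prob_compl del: space_beta_distribution)
qed

lemma beta_distribution_1_tail:
  assumes "0 < \<alpha>" shows "measure (beta_distribution 1 \<alpha>) {1 - exp (- s)<..} \<le> exp (- \<alpha> * s)"
proof (cases "s \<ge> 0")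
  case True
  then show ?thesis using assms by (subst beta_distribution_1_greaterThan) (auto simp: powr_def)
next
  case False
  then have "1 \<le> exp (- \<alpha> * s)" using assms by (simp add: mult_nonneg_nonpos)
  then show ?thesis
    using prob_space.prob_le_1[OF prob_space_beta_distribution] order_trans by blast
qed

text \<open>The overlap \<open>d\<close> covers the tail beyond \<open>q\<close> by an open interval
  and the tail beyond \<open>k\<close>, so no endpoint has to be treated.\<close>

lemma beta_distribution_1_interval:
  assumes "0 < \<alpha>" "0 \<le> q" "q < k" "k < 1" "0 < d"
  shows "(1 - q) powr \<alpha> - (1 - k) powr \<alpha> \<le> measure (beta_distribution 1 \<alpha>) {q<..<k+d}"
proof -
  interpret prob_space "beta_distribution 1 \<alpha>" by (rule prob_space_beta_distribution)
  have "prob {q<..} \<le> prob ({q<..<k+d} \<union> {k<..})"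
    using assms by (intro finite_measure_mono) auto
  also have "\<dots> \<le> prob {q<..<k+d} + prob {k<..}" by (intro measure_Un_le) auto
  finally show ?thesis using assms by (simp add: beta_distribution_1_greaterThan)
qed

text \<open>The Donsker--Varadhan dual form of the relative entropy, with a strict constraint so that it
  persists when \<open>w\<close> is perturbed.\<close>

lemma h_dual:
  assumes u: "0 \<le> u" "u < 1" and w: "0 \<le> w" "w \<le> 1" and t: "ereal t < h u w"
  obtains P Q where "0 < P" "0 < Q" "w * P + (1 - w) * Q < 1" "t < u * ln P + (1 - u) * ln Q"
proof -
  consider "w = 1" | "w = 0" "u > 0" | "w < 1" "u = 0" | "0 < w" "w < 1" "0 < u"
    using u w by linarith
  then show ?thesis
  proof cases
    case 1
    \<comment> \<open>Here \<open>Q\<close> has weight 0 in the constraint and can be as large as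
      needed; for \<open>w = 0\<close> the same is true of \<open>P\<close>.\<close>
    show ?thesis
    proof
      show "t < u * ln (1/2) + (1 - u) * ln (exp ((t - u * ln (1/2) + 1) / (1 - u)))"
        using u by simp
    qed (use 1 in auto)
  next
    case 2
    show ?thesis
    proof
      show "t < u * ln (exp ((t - (1 - u) * ln (1/2) + 1) / u)) + (1 - u) * ln (1/2)"
        using 2 by simp
    qed (use 2 in auto)
  next
    case 3
    have hu: "h u w = ereal (ln (1 / (1 - w)))" using 3 by (simp add: h_def xlog_def)
    define d where "d = ln (1 / (1 - w)) - t"
    have d: "d > 0" using t hu by (simp add: d_def)
    have t': "t = ln (1 / (1 - w)) - d" by (simp add: d_def)
    \<comment> \<open>With \<open>u = 0\<close> the objective ignores \<open>P\<close>, which only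
      has to be small enough for the constraint; \<open>Q\<close> is the optimal
      \<open>1 / (1 - w)\<close> shrunk by \<open>exp (- (d/2))\<close>.\<close>
    show ?thesis
    proof
      show "w * ((1 - exp (- (d/2))) / 2) + (1 - w) * (exp (- (d/2)) / (1 - w)) < 1"
      proof -
        define E where "E = exp (- (d/2))"
        have "E < 1" using d by (simp add: E_def)
        then have "w * ((1 - E) / 2) \<le> 1 * ((1 - E) / 2)"
          using w by (intro mult_right_mono) auto
        then have "w * ((1 - E) / 2) + E < 1" using \<open>E < 1\<close> by (simp add: field_simps)
        moreover have "(1 - w) * (E / (1 - w)) = E" using 3 by simp
        ultimately show ?thesis by (simp add: E_def)
      qed
      have "ln (exp (- (d/2)) / (1 - w)) = - (d/2) + ln (1 / (1 - w))"
        using 3 by (simp add: ln_div)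
      then show "t < u * ln ((1 - exp (- (d/2))) / 2) + (1 - u) * ln (exp (- (d/2)) / (1 - w))"
        using 3 d t' by simp
    qed (use 3 d in auto)
  next
    case 4
    let ?h = "u * ln (u / w) + (1 - u) * ln ((1 - u) / (1 - w))"
    have hu: "h u w = ereal ?h" using 4 u by (simp add: h_def xlog_def)
    define d where "d = ?h - t"
    have d: "d > 0" using t hu by (simp add: d_def)
    \<comment> \<open>The optimal pair \<open>u / w\<close>, \<open>(1 - u) / (1 - w)\<close>
      attains \<open>h\<close> with equality in the constraint. Scaling by
      \<open>exp (- (d/2))\<close> makes the constraint strict and costs half of the slack
      \<open>d\<close>.\<close>
    show ?thesis
    proof
      show "w * (exp (- (d/2)) * (u / w)) + (1 - w) * (exp (- (d/2)) * ((1 - u) / (1 - w))) < 1"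
      proof -
        have "w * (exp (- (d/2)) * (u / w)) + (1 - w) * (exp (- (d/2)) * ((1 - u) / (1 - w))) = exp (- (d/2))"
        proof -
          have "w * (exp (- (d/2)) * (u / w)) = exp (- (d/2)) * u"
            "(1 - w) * (exp (- (d/2)) * ((1 - u) / (1 - w))) = exp (- (d/2)) * (1 - u)"
            using 4 by simp_all
          then show ?thesis by (simp add: algebra_simps)
        qed
        then show ?thesis using d by simp
      qed
      have ln_eq: "ln (exp (- (d/2)) * (u / w)) = - (d/2) + ln (u / w)"
        "ln (exp (- (d/2)) * ((1 - u) / (1 - w))) = - (d/2) + ln ((1 - u) / (1 - w))"
        using 4 u ln_mult[of "exp (- (d/2))" "u / w"] ln_mult[of "exp (- (d/2))" "(1 - u) / (1 - w)"] by simp_all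
      have "u * (- (d/2) + ln (u / w)) + (1 - u) * (- (d/2) + ln ((1 - u) / (1 - w))) = ?h - d/2"
        by (simp only: ring_distribs)
      then show "t < u * ln (exp (- (d/2)) * (u / w)) + (1 - u) * ln (exp (- (d/2)) * ((1 - u) / (1 - w)))"
        unfolding ln_eq using d d_def by linarith
    qed (use 4 u in auto)
  qed
qed

section \<open>The laws as mixtures of product measures\<close>

lemma sum_stick_breaking: "(\<Sum>k<n. stick_breaking u k) = 1 - (\<Prod>k<n. 1 - u k)"
  by (induction n) (auto simp: stick_breaking_def algebra_simps)

lemma stick_breaking_in_simplex:
  assumes u: "\<And>n. u n \<in> {0..1}"
  shows "stick_breaking u \<in> infinite_simplex"
proof -
  have prod01: "0 \<le> (\<Prod>k<n. 1 - u k)" "(\<Prod>k<n. 1 - u k) \<le> 1" for n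
    using u by (auto intro!: prod_nonneg prod_le_1)
  have s01: "0 \<le> stick_breaking u n" "stick_breaking u n \<le> 1" for n
    using prod01[of n] u[of n] unfolding stick_breaking_def by (auto intro!: mult_le_one)
  have bd: "(\<Sum>k<n. stick_breaking u k) \<le> 1" for n
    using prod01 by (simp add: sum_stick_breaking)
  then have "summable (stick_breaking u)"
    using s01 by (intro bounded_imp_summable[where B = 1]) (metis lessThan_Suc_atMost)+
  then show ?thesis
    using s01 bd by (auto simp: infinite_simplex_def intro!: suminf_le_const)
qed

lemma continuous_on_stick_breaking_coordinate: "continuous_on A (\<lambda>u. stick_breaking u n)"
  unfolding stick_breaking_def
  by (intro continuous_intros continuous_on_subset[OF continuous_on_product_coordinates]) auto

lemma continuous_on_stick_breaking: "continuous_on A stick_breaking"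
  by (rule continuous_on_coordinatewise_then_product) (rule continuous_on_stick_breaking_coordinate)

lemma stick_breaking_borel [measurable]: "stick_breaking \<in> borel_measurable borel"
  by (intro borel_measurable_continuous_onI continuous_on_stick_breaking)

lemma coordinate_borel [measurable]: "(\<lambda>x::nat \<Rightarrow> real. x i) \<in> borel_measurable borel"
  by (intro borel_measurable_continuous_onI continuous_on_product_coordinates)

section \<open>Compactness of the cube and of the simplex\<close>

lemma compact_unit_cube: "compact {u::nat \<Rightarrow> real. \<forall>i. u i \<in> {0..1}}"
proof -
  have "compactin (product_topology (\<lambda>i::nat. euclidean) UNIV) (PiE UNIV (\<lambda>i. {0..1::real}))"
    by (subst compactin_PiE) auto
  then show ?thesis by (simp add: euclidean_product_topology PiE_UNIV_domain Pi_def)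
qed

text \<open>The infinite sum is not continuous in the product topology, whereas each partial sum is;
  this form exhibits the simplex as a closed subset of the cube.\<close>

lemma infinite_simplex_eq:
  "infinite_simplex = {p. \<forall>i. p i \<in> {0..1}} \<inter> (\<Inter>n. {p. (\<Sum>i<n. p i) \<le> 1})" (is "_ = ?R")
proof (intro equalityI subsetI)
  fix p assume p: "p \<in> infinite_simplex"
  then have "(\<Sum>i<n. p i) \<le> 1" for n
    using sum_le_suminf[of p "{..<n}"] by (fastforce simp: infinite_simplex_def)
  then show "p \<in> ?R" using p by (auto simp: infinite_simplex_def)
next
  fix p assume p: "p \<in> ?R"
  then have le: "(\<Sum>i<n. p i) \<le> 1" for n by auto
  have "summable p"
    using p le by (intro bounded_imp_summable[where B = 1]) (auto simp: lessThan_Suc_atMost[symmetric] simp del: sum.lessThan_Suc)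
  with p le show "p \<in> infinite_simplex"
    by (auto simp: infinite_simplex_def intro!: suminf_le_const)
qed

lemma compact_infinite_simplex: "compact infinite_simplex"
proof -
  have "closed {p::nat \<Rightarrow> real. (\<Sum>i<n. p i) \<le> 1}" for n
    by (intro closed_Collect_le continuous_intros continuous_on_product_coordinates)
  then have "closed (\<Inter>n. {p::nat \<Rightarrow> real. (\<Sum>i<n. p i) \<le> 1})" by auto
  then show ?thesis
    unfolding infinite_simplex_eq by (rule compact_Int_closed[OF compact_unit_cube])
qed

lemma infinite_simplex_borel [measurable]: "infinite_simplex \<in> sets borel"
  using compact_infinite_simplex by (simp add: borel_closed compact_imp_closed)

section \<open>Cylinder probabilities, measurability of the conditional law, mixture formula\<close>

lemma emeasure_PiM_cylinder:
  fixes M :: "nat \<Rightarrow> real measure"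
  assumes M: "\<And>i. prob_space (M i)" "\<And>i. sets (M i) = sets borel" and X: "\<And>i. i < m \<Longrightarrow> X i \<in> sets borel"
  shows "emeasure (PiM UNIV M) {w. \<forall>i<m. w i \<in> X i} = (\<Prod>i<m. emeasure (M i) (X i))"
proof -
  interpret product_prob_space M UNIV by (rule product_prob_spaceI) (rule M)
  have "space (PiM UNIV M) = UNIV"
    using sets_eq_imp_space_eq[OF M(2)] by (simp add: space_PiM)
  then show ?thesis using emeasure_PiM_Collect[of "{..<m}" X] X M(2) by (auto simp: Ball_def)
qed

lemma sets_PiM_borel: "(\<And>i. sets (M i) = sets borel) \<Longrightarrow> sets (PiM UNIV M) = sets (borel :: (nat \<Rightarrow> real) measure)"
  by (metis sets_PiM_cong sets_PiM_equal_borel)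

text \<open>The normalising constant is itself the integral of the kernel over the whole line, so
  away from the degenerate branches the probability is a quotient of two parameter integrals, each
  measurable in \<open>v\<close>.\<close>

lemma measurable_emeasure_beta_distribution:
  assumes [measurable]: "f \<in> borel_measurable M" "g \<in> borel_measurable M" "X \<in> sets borel"
  shows "(\<lambda>v. emeasure (beta_distribution (f v) (g v)) X) \<in> borel_measurable M"
proof -
  define I where "I Y v = (\<integral>\<^sup>+x. ennreal (x powr (f v - 1) * (1 - x) powr (g v - 1)) * indicator {0..1} x * indicator Y x \<partial>lborel)"
    for Y v
  have [measurable]: "(\<lambda>v. I Y v) \<in> borel_measurable M" if [measurable]: "Y \<in> sets borel" for Y
    unfolding I_def by measurable
  have "emeasure (beta_distribution (f v) (g v)) X =
      (if f v \<le> 0 then indicator X 0 else if g v \<le> 0 then indicator X 1 else I X v / I UNIV v)" for v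
  proof (cases "0 < f v \<and> 0 < g v")
    case True
    then have B: "I UNIV v = ennreal (Beta (f v) (g v))" "0 < Beta (f v) (g v)"
      by (auto simp: I_def nn_integral_beta_kernel Beta_pos)
    have "emeasure (beta_distribution (f v) (g v)) X = I X v / ennreal (Beta (f v) (g v))"
      using True B(2) unfolding I_def
      by (subst emeasure_beta_distribution)
         (auto simp: nn_integral_divide[symmetric] divide_ennreal[symmetric] indicator_def intro!: nn_integral_cong)
    then show ?thesis using True B by auto
  qed (auto simp: beta_distribution_def)
  then show ?thesis by (simp cong: measurable_cong)
qed

text \<open>Measurability of the kernel justifies evaluating the \<open>\<bind>\<close> in
  \<open>Q_law\<close>. It suffices to test an intersection-stable generator, on which the product
  measure is a finite product of Beta probabilities.\<close>

lemma W_kernel_measurable: "W_kernel \<beta> \<in> borel \<rightarrow>\<^sub>M prob_algebra borel"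
proof (rule measurable_prob_algebra_generated)
  let ?N = "\<lambda>_::nat. borel :: real measure"
  show "sets borel = sigma_sets (\<Pi>\<^sub>E i\<in>UNIV. space (?N i)) (prod_algebra UNIV ?N)"
    by (simp add: sets_PiM_equal_borel[symmetric] sets_PiM)
  show "Int_stable (prod_algebra UNIV ?N)" by (rule Int_stable_prod_algebra)
  show "prod_algebra UNIV ?N \<subseteq> Pow (\<Pi>\<^sub>E i\<in>UNIV. space (?N i))" by (rule prod_algebra_sets_into_space)
  fix v :: "nat \<Rightarrow> real"
  show "prob_space (W_kernel \<beta> v)"
    unfolding W_kernel_def by (intro prob_space_PiM prob_space_beta_distribution)
  show "sets (W_kernel \<beta> v) = sets borel"
    unfolding W_kernel_def by (rule sets_PiM_borel) simp
next
  fix A :: "(nat \<Rightarrow> real) set" assume "A \<in> prod_algebra UNIV (\<lambda>_. borel)"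
  then obtain J E where A: "A = prod_emb UNIV (\<lambda>_. borel) J (PiE J E)" "finite J"
      "\<And>i. i \<in> J \<Longrightarrow> E i \<in> sets (borel :: real measure)"
    by (rule prod_algebraE) auto
  have "emeasure (W_kernel \<beta> v) A =
    (\<Prod>i\<in>J. emeasure (beta_distribution (\<beta> * v i) (\<beta> * (1 - (\<Sum>k\<le>i. v k)))) (E i))" for v
  proof -
    interpret product_prob_space "\<lambda>n. beta_distribution (\<beta> * v n) (\<beta> * (1 - (\<Sum>k\<le>n. v k)))" UNIV
      by (intro product_prob_spaceI prob_space_beta_distribution)
    have "A = prod_emb UNIV (\<lambda>n. beta_distribution (\<beta> * v n) (\<beta> * (1 - (\<Sum>k\<le>n. v k)))) J (PiE J E)"
      unfolding A(1) prod_emb_def by simp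
    then show ?thesis unfolding W_kernel_def using A by (simp add: emeasure_PiM_emb)
  qed
  moreover have "(\<lambda>v. \<Prod>i\<in>J. emeasure (beta_distribution (\<beta> * v i) (\<beta> * (1 - (\<Sum>k\<le>i. v k)))) (E i))
     \<in> borel_measurable (borel :: (nat \<Rightarrow> real) measure)"
    by (intro borel_measurable_prod_ennreal measurable_emeasure_beta_distribution A) measurable
  ultimately show "(\<lambda>v. emeasure (W_kernel \<beta> v) A) \<in> borel_measurable borel" by simp
qed

text \<open>The law of the i.i.d. proportions. Pulling \<open>V_law\<close> back to it turns the
  mixing measure into a product measure.\<close>

definition U_law :: "real \<Rightarrow> (nat \<Rightarrow> real) measure" where
  "U_law \<alpha> = PiM UNIV (\<lambda>_. beta_distribution 1 \<alpha>)"

lemma sets_U_law [simp, measurable_cong]: "sets (U_law \<alpha>) = sets borel"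
  unfolding U_law_def by (rule sets_PiM_borel) simp

lemma sets_W_kernel [simp, measurable_cong]: "sets (W_kernel \<beta> v) = sets borel"
  unfolding W_kernel_def by (rule sets_PiM_borel) simp

lemma space_U_law [simp]: "space (U_law \<alpha>) = UNIV"
  by (simp add: sets_eq_imp_space_eq[OF sets_U_law])

lemma space_W_kernel [simp]: "space (W_kernel \<beta> v) = UNIV"
  by (simp add: sets_eq_imp_space_eq[OF sets_W_kernel])

lemma prob_space_U_law: "prob_space (U_law \<alpha>)"
  unfolding U_law_def by (intro prob_space_PiM prob_space_beta_distribution)

lemma prob_space_W_kernel: "prob_space (W_kernel \<beta> v)"
  unfolding W_kernel_def by (intro prob_space_PiM prob_space_beta_distribution)

lemma AE_U_law_interior: "0 < \<alpha> \<Longrightarrow> AE u in U_law \<alpha>. \<forall>i. u i \<in> {0<..<1}"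
  unfolding U_law_def AE_all_countable
  by (intro allI AE_PiM_component prob_space_beta_distribution AE_beta_distribution_interior) auto

lemma AE_W_kernel: "AE w in W_kernel \<beta> v. \<forall>i. w i \<in> {0..1}"
  unfolding W_kernel_def AE_all_countable
  by (intro allI AE_PiM_component prob_space_beta_distribution AE_beta_distribution) auto

text \<open>Stick breaking with proportions in the unit interval lands in the simplex, so the
  restriction in \<open>Q_law\<close> loses no mass.\<close>

lemma W_kernel_simplex: "emeasure (W_kernel \<beta> v) {w. stick_breaking w \<in> G \<inter> infinite_simplex}
    = emeasure (W_kernel \<beta> v) {w. stick_breaking w \<in> G}" if [measurable]: "G \<in> sets borel"
proof (rule emeasure_eq_AE)
  show "AE w in W_kernel \<beta> v. (w \<in> {w. stick_breaking w \<in> G \<inter> infinite_simplex}) = (w \<in> {w. stick_breaking w \<in> G})"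
    using AE_W_kernel[of \<beta> v] by eventually_elim (auto intro: stick_breaking_in_simplex)
qed (use measurable_sets[OF stick_breaking_borel, of "G \<inter> infinite_simplex"]
      measurable_sets[OF stick_breaking_borel, of G] that in \<open>simp_all add: vimage_def\<close>)

lemma W_kernel_subprob [measurable]: "W_kernel \<beta> \<in> borel \<rightarrow>\<^sub>M subprob_algebra borel"
  by (rule measurable_prob_algebraD[OF W_kernel_measurable])

lemma W_kernel_stick_breaking_measurable:
  assumes [measurable]: "G \<in> sets borel"
  shows "(\<lambda>u. emeasure (W_kernel \<beta> (stick_breaking u)) G) \<in> borel_measurable borel"
  by measurable

lemma V_law_eq: "V_law \<alpha> = distr (U_law \<alpha>) borel stick_breaking"
  by (simp add: V_law_def U_law_def)

lemma stick_breaking_kernel_measurable: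
  "(\<lambda>v. distr (W_kernel \<beta> v) borel stick_breaking) \<in> V_law \<alpha> \<rightarrow>\<^sub>M subprob_algebra borel"
  unfolding V_law_eq
  using measurable_compose[OF W_kernel_subprob measurable_distr[OF stick_breaking_borel]] by simp

lemma sets_mixture:
  "sets (V_law \<alpha> \<bind> (\<lambda>v. distr (W_kernel \<beta> v) borel stick_breaking)) = sets borel"
  using sets_bind[of "V_law \<alpha>", OF _ , of "\<lambda>v. distr (W_kernel \<beta> v) borel stick_breaking" borel]
  by (auto simp: V_law_eq)

lemma sets_Q_law: "sets (Q_law \<alpha> \<beta>) = sets (restrict_space borel infinite_simplex)"
  unfolding Q_law_def by (rule sets_restrict_space_cong[OF sets_mixture])

lemma space_Q_law: "space (Q_law \<alpha> \<beta>) = infinite_simplex"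
  unfolding Q_law_def space_restrict_space by (simp add: sets_eq_imp_space_eq[OF sets_mixture])

text \<open>The working formula for \<open>Q_law\<close>: both exponential bounds estimate this
  integral over the proportions \<open>u\<close>.\<close>

lemma emeasure_Q_law:
  assumes [measurable]: "G \<in> sets borel"
  shows "emeasure (Q_law \<alpha> \<beta>) (G \<inter> infinite_simplex) =
    (\<integral>\<^sup>+u. emeasure (W_kernel \<beta> (stick_breaking u)) {w. stick_breaking w \<in> G} \<partial>U_law \<alpha>)"
proof -
  let ?M = "V_law \<alpha> \<bind> (\<lambda>v. distr (W_kernel \<beta> v) borel stick_breaking)"
  have "emeasure (Q_law \<alpha> \<beta>) (G \<inter> infinite_simplex) = emeasure ?M (G \<inter> infinite_simplex)"
    unfolding Q_law_def
    by (rule emeasure_restrict_space) (auto simp: sets_mixture sets_eq_imp_space_eq[OF sets_mixture])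
  also have "\<dots> = (\<integral>\<^sup>+v. emeasure (distr (W_kernel \<beta> v) borel stick_breaking) (G \<inter> infinite_simplex) \<partial>V_law \<alpha>)"
    by (rule emeasure_bind[OF _ stick_breaking_kernel_measurable]) (auto simp: V_law_eq)
  also have "\<dots> = (\<integral>\<^sup>+v. emeasure (W_kernel \<beta> v) {w. stick_breaking w \<in> G} \<partial>V_law \<alpha>)"
    by (intro nn_integral_cong) (simp add: emeasure_distr vimage_def W_kernel_simplex[unfolded Int_iff])
  also have "\<dots> = (\<integral>\<^sup>+u. emeasure (W_kernel \<beta> (stick_breaking u)) {w. stick_breaking w \<in> G} \<partial>U_law \<alpha>)"
    unfolding V_law_eq by (intro nn_integral_distr) measurable
  finally show ?thesis .
qed

lemma prob_space_Q_law: "prob_space (Q_law \<alpha> \<beta>)"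
proof
  show "emeasure (Q_law \<alpha> \<beta>) (space (Q_law \<alpha> \<beta>)) = 1"
    using emeasure_Q_law[of UNIV \<alpha> \<beta>] prob_space.emeasure_space_1[OF prob_space_W_kernel]
      prob_space.emeasure_space_1[OF prob_space_U_law] by (simp add: space_Q_law)
qed

lemma emeasure_U_law_cylinder:
  "(\<And>i. i < m \<Longrightarrow> X i \<in> sets borel) \<Longrightarrow>
    emeasure (U_law \<alpha>) {u. \<forall>i<m. u i \<in> X i} = (\<Prod>i<m. emeasure (beta_distribution 1 \<alpha>) (X i))"
  unfolding U_law_def by (rule emeasure_PiM_cylinder) (auto simp: prob_space_beta_distribution)

text \<open>In terms of the stick-breaking proportions \<open>u\<close>, the parameters of \<open>W\<^sub>i\<close> are
  \<open>\<beta> T u\<^sub>i\<close> and \<open>\<beta> T (1 - u\<^sub>i)\<close>, where \<open>T\<close> is the length of the stick before its break number \<open>i\<close>.\<close>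

lemma emeasure_W_kernel_cylinder:
  assumes "\<And>i. i < m \<Longrightarrow> X i \<in> sets borel"
  shows "emeasure (W_kernel \<beta> (stick_breaking u)) {w. \<forall>i<m. w i \<in> X i} =
    (\<Prod>i<m. emeasure (beta_distribution (\<beta> * (\<Prod>j<i. 1 - u j) * u i) (\<beta> * (\<Prod>j<i. 1 - u j) * (1 - u i))) (X i))"
proof -
  have "1 - (\<Sum>k\<le>i. stick_breaking u k) = (\<Prod>j<i. 1 - u j) * (1 - u i)" for i
    using sum_stick_breaking[of u "Suc i"] by (simp add: lessThan_Suc_atMost[symmetric])
  then have "W_kernel \<beta> (stick_breaking u) = PiM UNIV (\<lambda>i.
    beta_distribution (\<beta> * (\<Prod>j<i. 1 - u j) * u i) (\<beta> * (\<Prod>j<i. 1 - u j) * (1 - u i)))"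
    unfolding W_kernel_def by (simp add: stick_breaking_def mult.assoc)
  then show ?thesis
    using assms by (simp add: emeasure_PiM_cylinder prob_space_beta_distribution)
qed

section \<open>Upper bound\<close>

text \<open>Basic open sets of the product topology restrict finitely many coordinates, and a
  minimum of radii makes the tolerance uniform. This reduces the lower bound to finitely many
  coordinates.\<close>

lemma eventually_nhds_cylinder:
  fixes u :: "nat \<Rightarrow> real"
  assumes "\<forall>\<^sub>F x in nhds u. R x"
  shows "\<exists>e M. 0 < e \<and> (\<forall>x. (\<forall>i<M. \<bar>x i - u i\<bar> < e) \<longrightarrow> R x)"
proof -
  obtain A where A: "open A" "u \<in> A" "\<And>x. x \<in> A \<Longrightarrow> R x"
    using assms unfolding eventually_nhds by blast
  have "openin (product_topology (\<lambda>i::nat. euclidean) UNIV) A"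
    using A(1) by (simp add: euclidean_product_topology)
  from product_topology_open_contains_basis[OF this A(2)]
  obtain V where V: "u \<in> (\<Pi>\<^sub>E i\<in>UNIV. V i)" "\<And>i. open (V i)"
      "finite {i. V i \<noteq> (UNIV :: real set)}" "(\<Pi>\<^sub>E i\<in>UNIV. V i) \<subseteq> A"
    by auto
  obtain M where M: "\<And>i. V i \<noteq> UNIV \<Longrightarrow> i < M"
    using V(3) unfolding finite_nat_set_iff_bounded by blast
  have "\<forall>i. \<exists>e>0. ball (u i) e \<subseteq> V i"
    using V(1,2) by (auto simp: open_contains_ball PiE_iff)
  then obtain e where e: "\<And>i. e i > 0" "\<And>i. ball (u i) (e i) \<subseteq> V i" by metis
  \<comment> \<open>The inserted 1 keeps the minimum meaningful when \<open>M = 0\<close>.\<close>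
  let ?e = "Min (insert 1 (e ` {..<M}))"
  show ?thesis
  proof (intro exI conjI allI impI)
    show "0 < ?e" using e by (subst Min_gr_iff) auto
    fix x assume x: "\<forall>i<M. \<bar>x i - u i\<bar> < ?e"
    have "x i \<in> V i" for i
    proof (cases "i < M")
      case True
      then have "?e \<le> e i" by (intro Min_le) auto
      with x True have "\<bar>x i - u i\<bar> < e i" by (blast intro: order.strict_trans2)
      then have "x i \<in> ball (u i) (e i)" by (simp add: dist_real_def abs_minus_commute)
      then show ?thesis using e by blast
    next
      case False then show ?thesis using M by blast
    qed
    then show "R x" using V(4) A(3) by (auto simp: PiE_iff)
  qed
qed

lemma tendsto_coordinate: "((\<lambda>x::nat \<Rightarrow> real. x i) \<longlongrightarrow> u i) (nhds u)"
  using continuous_on_product_coordinates[of i]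
  by (metis UNIV_I continuous_on_eq_continuous_at isCont_def open_UNIV tendsto_at_iff_tendsto_nhds)

lemma ereal_less_add_split:
  fixes a b :: ereal
  assumes "ereal r < a + b" "a \<noteq> -\<infinity>" "b \<noteq> -\<infinity>"
  obtains x y where "ereal x < a" "ereal y < b" "r < x + y"
proof -
  obtain x0 y0 where 0: "ereal x0 < a" "ereal y0 < b"
    using assms(2,3) by (metis ereal_dense2 ereal_infty_less(2))
  consider "a = \<infinity>" | "b = \<infinity>" | a' b' where "a = ereal a'" "b = ereal b'"
    using assms by (cases a; cases b) auto
  then show ?thesis
  proof cases
    case 1 then show ?thesis using 0 by (intro that[of "r - y0 + 1" y0]) auto
  next
    case 2 then show ?thesis using 0 by (intro that[of x0 "r - x0 + 1"]) auto
  next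
    case 3
    then show ?thesis using assms(1)
      by (intro that[of "a' - (a' + b' - r) / 3" "b' - (a' + b' - r) / 3"]) (auto simp: field_simps)
  qed
qed

text \<open>Summands may be infinite; a finite target below each of them lets the coordinates be
  treated separately.\<close>

lemma ereal_less_sum_split:
  fixes f :: "nat \<Rightarrow> ereal"
  assumes "ereal r < (\<Sum>i<m. f i)" "\<And>i. i < m \<Longrightarrow> f i \<noteq> -\<infinity>"
  obtains g where "\<And>i. i < m \<Longrightarrow> ereal (g i) < f i" "r < (\<Sum>i<m. g i)"
  using assms
proof (induction m arbitrary: r thesis)
  case 0
  then show ?case by (auto simp: zero_ereal_def)
next
  case (Suc m)
  have "k \<le> m \<Longrightarrow> (\<Sum>i<k. f i) \<noteq> -\<infinity>" for k
    using Suc.prems(3) by (induction k) auto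
  then have "(\<Sum>i<m. f i) \<noteq> -\<infinity>" by simp
  then obtain x y where xy: "ereal x < (\<Sum>i<m. f i)" "ereal y < f m" "r < x + y"
    using Suc.prems by (auto elim!: ereal_less_add_split)
  obtain g where g: "\<And>i. i < m \<Longrightarrow> ereal (g i) < f i" "x < (\<Sum>i<m. g i)"
    using Suc.IH[OF _ xy(1)] Suc.prems(3) by (metis less_Suc_eq)
  show ?case
    by (rule Suc.prems(1)[of "g(m := y)"]) (use g xy in \<open>auto simp: less_Suc_eq\<close>)
qed

lemma xlog_neq_minf: "xlog x y \<noteq> -\<infinity>"
  by (simp add: xlog_def)

lemma h_neq_minf: "h u w \<noteq> -\<infinity>"
  using xlog_neq_minf by (simp add: h_def)

text \<open>Turns a bound on one summand of the cost into strict inequalities that survive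
  perturbation: a tail level \<open>s\<close> for \<open>u\<close>, and a dual pair with value above
  \<open>t\<close> for \<open>w\<close>.\<close>

lemma cost_term_dual:
  assumes u: "0 \<le> u" "u < 1" and w: "0 \<le> w" "w \<le> 1" and pos: "0 < a" "0 < b" "0 < T"
    and g: "ereal g < ereal (a * ln (1 / (1 - u))) + ereal (b * T) * h u w"
  obtains s t P Q where "1 - exp (- s) < u" "0 < P" "0 < Q" "w * P + (1 - w) * Q < 1"
    "t < T * (u * ln P + (1 - u) * ln Q)" "g < a * s + b * t"
proof -
  define L where "L = ln (1 / (1 - u))"
  \<comment> \<open>The value \<open>h u w\<close> must exceed for the summand to exceed
    \<open>g\<close>.\<close>
  define t' where "t' = (g - a * L) / (b * T)"
  have "ereal t' < h u w"
  proof (cases "h u w")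
    case (real x)
    then show ?thesis using g pos by (simp add: t'_def L_def field_simps)
  qed (use h_neq_minf in auto)
  then obtain P Q where PQ: "0 < P" "0 < Q" "w * P + (1 - w) * Q < 1" "t' < u * ln P + (1 - u) * ln Q"
    using h_dual[OF u w] by metis
  define v where "v = u * ln P + (1 - u) * ln Q"
  have "t' * (b * T) < v * (b * T)" using PQ(4) pos by (intro mult_strict_right_mono) (auto simp: v_def)
  moreover have "t' * (b * T) = g - a * L" using pos by (simp add: t'_def)
  ultimately have gv: "g < a * L + b * (T * v)" by (simp add: algebra_simps)
  \<comment> \<open>Lowering both \<open>s\<close> and \<open>t\<close> by \<open>d\<close> costs
    \<open>(a + b) * d\<close>, which is half of the slack.\<close>
  define d where "d = (a * L + b * (T * v) - g) / (2 * (a + b))"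
  have d: "d > 0" using gv pos by (simp add: d_def)
  show ?thesis
  proof
    have "exp (- L) < exp (- (L - d))" using d by simp
    then show "1 - exp (- (L - d)) < u" using u by (simp add: L_def exp_minus)
    show "T * v - d < T * (u * ln P + (1 - u) * ln Q)" using d by (simp add: v_def)
    have "(a + b) * d = (a * L + b * (T * v) - g) / 2" using pos by (simp add: d_def field_simps)
    then have "a * d + b * d = (a * L + b * (T * v) - g) / 2" by (simp add: algebra_simps)
    then show "g < a * (L - d) + b * (T * v - d)" using gv by (simp add: algebra_simps)
  qed (use PQ in auto)
qed

lemma open_Collect_cylinder:
  fixes m :: nat
  assumes "\<And>i. i < m \<Longrightarrow> open {x. R i x}"
  shows "open {x. \<forall>i<m. R i x}"
proof -
  have "{x. \<forall>i<m. R i x} = (\<Inter>i\<in>{..<m}. {x. R i x})" by auto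
  then show ?thesis using assms by (auto intro!: open_INT)
qed

definition cost :: "real \<Rightarrow> real \<Rightarrow> nat \<Rightarrow> (nat \<Rightarrow> real) \<Rightarrow> (nat \<Rightarrow> real) \<Rightarrow> ereal" where
  "cost a b m u w = (\<Sum>i<m. ereal (a * ln (1 / (1 - u i)))
                            + ereal (b * (\<Prod>j<i. 1 - u j)) * h (u i) (w i))"

lemma rate_m_eq: "rate_m c m z = Inf {cost (coeff_a c) (coeff_b c) m u w | u w.
      (\<forall>i<m. 0 \<le> u i \<and> u i < 1 \<and> 0 \<le> w i \<and> w i \<le> 1) \<and> (\<forall>i<m. stick_breaking w i = z i)}"
  unfolding rate_m_def cost_def ..

text \<open>The estimates see the parameters only through the limits \<open>a\<close> and
  \<open>b\<close>; the distinction of cases in \<open>c\<close> is postponed to the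
  instantiation.\<close>

locale scaled_parameters =
  fixes \<alpha> \<beta> \<gamma> :: "nat \<Rightarrow> real" and a b :: real
  assumes pos: "\<And>n. 0 < \<alpha> n" "\<And>n. 0 < \<beta> n" "\<And>n. 0 < \<gamma> n" "0 < a" "0 < b"
    and at_top: "filterlim \<alpha> at_top sequentially" "filterlim \<beta> at_top sequentially" "filterlim \<gamma> at_top sequentially"
    and ratio: "(\<lambda>n. \<alpha> n / \<gamma> n) \<longlonglongrightarrow> a" "(\<lambda>n. \<beta> n / \<gamma> n) \<longlonglongrightarrow> b"
begin

lemma exponent_tendsto:
  "(\<lambda>n. (\<alpha> n * s + \<beta> n * t) / \<gamma> n) \<longlonglongrightarrow> a * s + b * t"
proof -
  have "(\<lambda>n. \<alpha> n / \<gamma> n * s + \<beta> n / \<gamma> n * t) \<longlonglongrightarrow> a * s + b * t"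
    by (intro tendsto_intros ratio)
  then show ?thesis by (simp add: add_divide_distrib)
qed

text \<open>On \<open>A\<close> the dual exponents stay above \<open>t\<close>, so the conditional
  Chernoff bounds hold with one constant for all \<open>u'\<close> in \<open>A\<close>. The integral
  is then at most this constant times a product of Beta(1, \<alpha>) tails.\<close>

lemma joint_box_upper_bound:
  assumes box: "\<And>i. i < m \<Longrightarrow> 1 - exp (- s i) < u i \<and> 0 < P i \<and> 0 < Q i \<and> w i * P i + (1 - w i) * Q i < 1 \<and>
      t i < (\<Prod>j<i. 1 - u j) * (u i * ln (P i) + (1 - u i) * ln (Q i))"
    and r: "r < (\<Sum>i<m. a * s i + b * t i)"
  shows "\<exists>A B. open A \<and> open B \<and> u \<in> A \<and> w \<in> B \<and>
    (\<forall>\<^sub>F n in sequentially. (\<integral>\<^sup>+u'. emeasure (W_kernel (\<beta> n) (stick_breaking u')) B * indicator A u' \<partial>U_law (\<alpha> n))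
      \<le> ennreal (exp (- \<gamma> n * r)))"
proof -
  define f where "f i u' = (\<Prod>j<i. 1 - u' j) * (u' i * ln (P i) + (1 - u' i) * ln (Q i))" for i and u' :: "nat \<Rightarrow> real"
  define A where "A = {u'. \<forall>i<m. 1 - exp (- s i) < u' i \<and> t i < f i u'}"
  define B where "B = {w'. \<forall>i<m. w' i \<in> {y. y * P i + (1 - y) * Q i < 1}}"
  have A: "open A"
    unfolding A_def f_def
    by (intro open_Collect_cylinder open_Collect_conj open_Collect_less continuous_intros
        continuous_on_product_coordinates)
  have oB: "open {y. y * P i + (1 - y) * Q i < 1}" for i
    by (intro open_Collect_less continuous_intros)
  have B: "open B"
    unfolding B_def mem_Collect_eq
    by (intro open_Collect_cylinder open_Collect_less continuous_intros continuous_on_product_coordinates)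
  have mem: "u \<in> A" "w \<in> B" using box by (auto simp: A_def B_def f_def)
  have S: "(\<Sum>i<m. a * s i + b * t i) = a * (\<Sum>i<m. s i) + b * (\<Sum>i<m. t i)"
    by (simp add: sum.distrib sum_distrib_left)
  have "\<forall>\<^sub>F n in sequentially. r < (\<alpha> n * (\<Sum>i<m. s i) + \<beta> n * (\<Sum>i<m. t i)) / \<gamma> n"
    using order_tendstoD(1)[OF exponent_tendsto] r unfolding S by blast
  then have "\<forall>\<^sub>F n in sequentially. (\<integral>\<^sup>+u'. emeasure (W_kernel (\<beta> n) (stick_breaking u')) B * indicator A u' \<partial>U_law (\<alpha> n))
      \<le> ennreal (exp (- \<gamma> n * r))"
  proof eventually_elim
    case (elim n)
    \<comment> \<open>\<open>A\<close> couples the coordinates through the stick lengths. Dropping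
      that condition gives a product event, whose probability factorises.\<close>
    define A' where "A' = {u'::nat \<Rightarrow> real. \<forall>i<m. u' i \<in> {1 - exp (- s i)<..}}"
    have [measurable]: "A' \<in> sets borel"
      unfolding A'_def mem_Collect_eq greaterThan_iff
      by (intro borel_open open_Collect_cylinder open_Collect_less continuous_intros continuous_on_product_coordinates)
    define C where "C = ennreal (\<Prod>i<m. exp (- \<beta> n * t i))"
    have kernel: "emeasure (W_kernel (\<beta> n) (stick_breaking u')) B \<le> C"
      if u': "\<forall>i. u' i \<in> {0<..<1}" "u' \<in> A" for u'
    proof -
      have Tpos: "0 < (\<Prod>j<i. 1 - u' j)" for i using u' by (auto intro!: prod_pos)
      have "emeasure (beta_distribution (\<beta> n * (\<Prod>j<i. 1 - u' j) * u' i) (\<beta> n * (\<Prod>j<i. 1 - u' j) * (1 - u' i)))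
          {y. y * P i + (1 - y) * Q i < 1} \<le> ennreal (exp (- \<beta> n * t i))" (is "emeasure (beta_distribution ?A ?B) ?X \<le> _")
        if i: "i < m" for i
      proof -
        interpret prob_space "beta_distribution ?A ?B" by (rule prob_space_beta_distribution)
        have "measure (beta_distribution ?A ?B) ?X \<le> P i powr - ?A * Q i powr - ?B"
          using box[OF i] u' Tpos pos(2)[of n] oB
          by (intro beta_distribution_chernoff mult_pos_pos) (auto simp: less_imp_le borel_open)
        also have "\<dots> = exp (- \<beta> n * f i u')"
          using box[OF i] by (simp add: powr_def f_def exp_add[symmetric] algebra_simps)
        also have "\<dots> \<le> exp (- \<beta> n * t i)"
          using u'(2) i pos(2)[of n] by (auto simp: A_def)
        finally show ?thesis by (simp add: emeasure_eq_measure ennreal_leI)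
      qed
      then show ?thesis
        unfolding B_def C_def using oB
        by (subst emeasure_W_kernel_cylinder) (auto simp: prod_ennreal[symmetric] borel_open intro!: prod_mono_ennreal)
    qed
    have "(\<integral>\<^sup>+u'. emeasure (W_kernel (\<beta> n) (stick_breaking u')) B * indicator A u' \<partial>U_law (\<alpha> n))
       \<le> (\<integral>\<^sup>+u'. C * indicator A' u' \<partial>U_law (\<alpha> n))"
      \<comment> \<open>The Chernoff bound requires positive Beta parameters, which holds for
        interior \<open>u'\<close>.\<close>
      using AE_U_law_interior[OF pos(1)]
    proof (intro nn_integral_mono_AE, eventually_elim)
      case (elim u')
      then show ?case using kernel[of u'] by (auto simp: indicator_def A_def A'_def)
    qed
    also have "\<dots> = C * emeasure (U_law (\<alpha> n)) A'" by (rule nn_integral_cmult_indicator) simp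
    also have "emeasure (U_law (\<alpha> n)) A' \<le> ennreal (\<Prod>i<m. exp (- \<alpha> n * s i))"
      unfolding A'_def
      by (subst emeasure_U_law_cylinder)
         (auto simp: prod_ennreal[symmetric] intro!: prod_mono_ennreal ennreal_leI beta_distribution_1_tail[OF pos(1), simplified]
           simp: finite_measure.emeasure_eq_measure[OF prob_space.finite_measure[OF prob_space_beta_distribution]])
    also have "C * ennreal (\<Prod>i<m. exp (- \<alpha> n * s i)) =
        ennreal (exp (- (\<alpha> n * (\<Sum>i<m. s i) + \<beta> n * (\<Sum>i<m. t i))))"
      by (simp add: C_def ennreal_mult'[symmetric] prod_nonneg exp_sum[symmetric] exp_add[symmetric]
          sum_negf sum_distrib_left[symmetric] algebra_simps)
    also have "\<dots> \<le> ennreal (exp (- \<gamma> n * r))"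
      using elim pos(3)[of n] by (intro ennreal_leI) (simp add: field_simps)
    finally show ?case by (simp add: mult_left_mono)
  qed
  then show ?thesis using A B mem by blast
qed

lemma joint_local_upper_bound:
  assumes uw: "\<And>i. u i \<in> {0..1}" "\<And>i. w i \<in> {0..1}"
    and r: "(\<exists>k<m. u k = 1) \<or> ereal r < cost a b m u w"
  shows "\<exists>A B. open A \<and> open B \<and> u \<in> A \<and> w \<in> B \<and>
    (\<forall>\<^sub>F n in sequentially. (\<integral>\<^sup>+u'. emeasure (W_kernel (\<beta> n) (stick_breaking u')) B * indicator A u' \<partial>U_law (\<alpha> n))
      \<le> ennreal (exp (- \<gamma> n * r)))"
proof (cases "\<exists>k<m. u k = 1")
  case True
  then obtain k where k: "k < m" "u k = 1" by blast
  \<comment> \<open>Every coordinate gets \<open>t = -1\<close>, guaranteed by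
    \<open>P = Q = 1/2\<close> since stick lengths are at most 1 and \<open>ln 2 < 1\<close>; all
    but \<open>k\<close> get \<open>s = -1\<close>. As \<open>u k = 1\<close> permits any
    \<open>s k\<close>, it is chosen to make the total equal \<open>r + a\<close>.\<close>
  define s where "s i = (if i = k then (r + m * (a + b)) / a else - 1)" for i
  have ln2: "ln (1/2) > (-1::real)"
    using ln_2_less_1 by (simp add: ln_div)
  show ?thesis
  proof (rule joint_box_upper_bound)
    fix i assume i: "i < m"
    have "0 \<le> (\<Prod>j<i. 1 - u j)" "(\<Prod>j<i. 1 - u j) \<le> 1"
      using uw by (auto intro!: prod_nonneg prod_le_1)
    then have "(\<Prod>j<i. 1 - u j) * - ln (1/2) \<le> 1 * - ln (1/2)"
      by (intro mult_right_mono) auto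
    moreover have "(\<Prod>j<i. 1 - u j) * (u i * ln (1/2) + (1 - u i) * ln (1/2)) = - ((\<Prod>j<i. 1 - u j) * - ln (1/2))"
      by (simp add: algebra_simps)
    ultimately have "- 1 < (\<Prod>j<i. 1 - u j) * (u i * ln (1/2) + (1 - u i) * ln (1/2))"
      using ln2 by linarith
    moreover have "1 - exp (- s i) < u i"
    proof (cases "i = k")
      case True then show ?thesis using k by simp
    next
      case False
      then have "1 - exp (- s i) < 0" by (simp add: s_def)
      then show ?thesis using uw(1)[of i] by (meson atLeastAtMost_iff less_le_trans)
    qed
    ultimately show "1 - exp (- s i) < u i \<and> 0 < (1/2::real) \<and> 0 < (1/2::real) \<and> w i * (1/2) + (1 - w i) * (1/2) < 1 \<and>
      - 1 < (\<Prod>j<i. 1 - u j) * (u i * ln (1/2) + (1 - u i) * ln (1/2))" by (simp add: field_simps)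
  next
    have "(\<Sum>i<m. a * s i + b * - 1) = (\<Sum>i<m. (if i = k then a * ((r + m * (a + b)) / a) + a else 0) - (a + b))"
      by (intro sum.cong) (auto simp: s_def)
    also have "\<dots> = a * ((r + m * (a + b)) / a) + a - m * (a + b)"
      using k by (simp add: sum_subtractf)
    also have "\<dots> = r + a" using pos by simp
    finally show "r < (\<Sum>i<m. a * s i + b * - 1)" using pos by simp
  qed
next
  case False
  then have u1: "u i < 1" if "i < m" for i using uw(1)[of i] that by (metis atLeastAtMost_iff order_le_less)
  let ?T = "\<lambda>i. \<Prod>j<i. 1 - u j"
  have T: "0 < ?T i" if "i < m" for i using u1 that by (auto intro!: prod_pos)
  have "ereal (a * ln (1 / (1 - u i))) + ereal (b * ?T i) * h (u i) (w i) \<noteq> -\<infinity>" if "i < m" for i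
    using h_neq_minf[of "u i" "w i"] T[OF that] pos by (cases "h (u i) (w i)") auto
  moreover have "ereal r < (\<Sum>i<m. ereal (a * ln (1 / (1 - u i))) + ereal (b * ?T i) * h (u i) (w i))"
    using r False by (auto simp: cost_def)
  ultimately obtain g where g: "\<And>i. i < m \<Longrightarrow> ereal (g i) < ereal (a * ln (1 / (1 - u i))) + ereal (b * ?T i) * h (u i) (w i)"
    "r < (\<Sum>i<m. g i)"
    by (metis (lifting) ereal_less_sum_split)
  have "\<forall>i. \<exists>s t P Q. i < m \<longrightarrow> 1 - exp (- s) < u i \<and> 0 < P \<and> 0 < Q \<and> w i * P + (1 - w i) * Q < 1 \<and>
      t < ?T i * (u i * ln P + (1 - u i) * ln Q) \<and> g i < a * s + b * t"
  proof
    fix i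
    show "\<exists>s t P Q. i < m \<longrightarrow> 1 - exp (- s) < u i \<and> 0 < P \<and> 0 < Q \<and> w i * P + (1 - w i) * Q < 1 \<and>
      t < ?T i * (u i * ln P + (1 - u i) * ln Q) \<and> g i < a * s + b * t"
    proof (cases "i < m")
      case True
      show ?thesis
        by (rule cost_term_dual[OF _ _ _ _ pos(4,5) T[OF True] g(1)[OF True]])
           (use uw[of i] u1[OF True] True in auto)
    qed simp
  qed
  then obtain s t P Q where stPQ: "\<And>i. i < m \<Longrightarrow> 1 - exp (- s i) < u i \<and> 0 < P i \<and> 0 < Q i \<and> w i * P i + (1 - w i) * Q i < 1 \<and>
      t i < ?T i * (u i * ln (P i) + (1 - u i) * ln (Q i)) \<and> g i < a * s i + b * t i"
    by metis
  have "(\<Sum>i<m. g i) \<le> (\<Sum>i<m. a * s i + b * t i)"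
    using stPQ by (intro sum_mono) (auto simp: less_imp_le)
  then have "r < (\<Sum>i<m. a * s i + b * t i)" using g(2) by linarith
  then show ?thesis
    by (rule joint_box_upper_bound[where s = s and t = t and P = P and Q = Q, rotated]) (use stPQ in blast)
qed

text \<open>The fibre of the stick-breaking map over the first \<open>m\<close> coordinates of \<open>z\<close> is compact, so
  finitely many local bounds cover it; as the map is closed on the cube, the cover absorbs the
  preimage of a whole neighbourhood of \<open>z\<close>.\<close>

lemma Q_law_local_upper_bound:
  assumes z: "ereal r < Inf {cost a b m u w | u w.
      (\<forall>i<m. 0 \<le> u i \<and> u i < 1 \<and> 0 \<le> w i \<and> w i \<le> 1) \<and> (\<forall>i<m. stick_breaking w i = z i)}"
  obtains N C where "open N" "z \<in> N"
    "\<forall>\<^sub>F n in sequentially. measure (Q_law (\<alpha> n) (\<beta> n)) (N \<inter> infinite_simplex) \<le> C * exp (- \<gamma> n * r)"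
proof -
  define E where "E = {u::nat \<Rightarrow> real. \<forall>i. u i \<in> {0..1}}"
  define F where "F = {x \<in> E \<times> E. \<forall>i<m. stick_breaking (snd x) i = z i}"
  define bnd where "bnd A B \<longleftrightarrow> (\<forall>\<^sub>F n in sequentially.
      (\<integral>\<^sup>+u'. emeasure (W_kernel (\<beta> n) (stick_breaking u')) B * indicator A u' \<partial>U_law (\<alpha> n))
      \<le> ennreal (exp (- \<gamma> n * r)))" for A B
  have cE: "compact (E \<times> E)" unfolding E_def by (intro compact_Times compact_unit_cube)
  have cont: "continuous_on S (\<lambda>x. stick_breaking (snd x) i)" for i and S :: "((nat \<Rightarrow> real) \<times> (nat \<Rightarrow> real)) set"
    by (rule continuous_on_compose2[OF continuous_on_stick_breaking_coordinate[of UNIV] continuous_on_snd]) auto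
  have "closed (\<Inter>i\<in>{..<m}. {x :: (nat \<Rightarrow> real) \<times> (nat \<Rightarrow> real). stick_breaking (snd x) i = z i})"
    by (intro closed_INT ballI closed_Collect_eq cont continuous_on_const)
  moreover have "F = (E \<times> E) \<inter> (\<Inter>i\<in>{..<m}. {x. stick_breaking (snd x) i = z i})"
    by (auto simp: F_def)
  ultimately have cF: "compact F" using cE by (simp add: compact_Int_closed)
  have "\<forall>x\<in>F. \<exists>A B. open A \<and> open B \<and> fst x \<in> A \<and> snd x \<in> B \<and> bnd A B"
    unfolding bnd_def
  proof (intro ballI joint_local_upper_bound)
    fix x assume x: "x \<in> F"
    then show xE: "fst x i \<in> {0..1}" "snd x i \<in> {0..1}" for i by (auto simp: F_def E_def)
    show "(\<exists>k<m. fst x k = 1) \<or> ereal r < cost a b m (fst x) (snd x)"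
    proof (cases "\<exists>k<m. fst x k = 1")
      case False
      then have "\<forall>i<m. 0 \<le> fst x i \<and> fst x i < 1 \<and> 0 \<le> snd x i \<and> snd x i \<le> 1"
        using xE by (metis atLeastAtMost_iff order_le_less)
      then have "Inf {cost a b m u w | u w.
        (\<forall>i<m. 0 \<le> u i \<and> u i < 1 \<and> 0 \<le> w i \<and> w i \<le> 1) \<and> (\<forall>i<m. stick_breaking w i = z i)}
        \<le> cost a b m (fst x) (snd x)"
        using x by (intro Inf_lower) (auto simp: F_def)
      then show ?thesis using z by (meson order.strict_trans2)
    qed simp
  qed
  then obtain A B where AB: "\<And>x. x \<in> F \<Longrightarrow> open (A x) \<and> open (B x) \<and> fst x \<in> A x \<and> snd x \<in> B x \<and> bnd (A x) (B x)"
    by metis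
  have "open (A x \<times> B x)" if "x \<in> F" for x using AB[OF that] by (simp add: open_Times)
  moreover have "F \<subseteq> (\<Union>x\<in>F. A x \<times> B x)"
  proof
    fix x assume "x \<in> F"
    then show "x \<in> (\<Union>x\<in>F. A x \<times> B x)" using AB by (intro UN_I[of x]) (auto simp: mem_Times_iff)
  qed
  ultimately obtain D where D: "D \<subseteq> F" "finite D" "F \<subseteq> (\<Union>x\<in>D. A x \<times> B x)"
    by (rule compactE_image[OF cF])
  \<comment> \<open>Zeroing the later coordinates turns agreement in the first \<open>m\<close>
    coordinates into equality of points.\<close>
  define tr where "tr y i = (if i < m then y i else (0::real))" for y :: "nat \<Rightarrow> real" and i
  have "continuous_on S (\<lambda>y. tr y i)" for S i
    unfolding tr_def
    by (cases "i < m") (auto intro: continuous_on_subset[OF continuous_on_product_coordinates])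
  then have tr_cont: "continuous_on S tr" for S
    by (rule continuous_on_coordinatewise_then_product)
  \<comment> \<open>\<open>R\<close> is the uncovered part of the cube. Its image is compact and
    misses \<open>tr z\<close>, so the complement pulls back to a neighbourhood \<open>N\<close> of
    \<open>z\<close> whose preimage in the cube lies in the finite cover.\<close>
  define R where "R = (E \<times> E) - (\<Union>x\<in>D. A x \<times> B x)"
  have "compact R"
    unfolding R_def using D AB by (intro compact_diff cE open_UN ballI open_Times) auto
  moreover have "continuous_on R (\<lambda>x. tr (stick_breaking (snd x)))"
    by (intro continuous_on_compose2[OF tr_cont[of UNIV]] continuous_on_coordinatewise_then_product cont) auto
  ultimately have "compact ((\<lambda>x. tr (stick_breaking (snd x))) ` R)" by (rule compact_continuous_image[rotated])
  then have clR: "closed ((\<lambda>x. tr (stick_breaking (snd x))) ` R)" by (rule compact_imp_closed)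
  define N where "N = tr -` (- (\<lambda>x. tr (stick_breaking (snd x))) ` R)"
  have N: "open N" unfolding N_def
    using clR tr_cont[of UNIV] by (intro open_vimage) (auto simp: open_Compl)
  have zN: "z \<in> N"
  proof (rule ccontr)
    assume "z \<notin> N"
    then obtain x where x: "x \<in> R" "tr z = tr (stick_breaking (snd x))" by (auto simp: N_def)
    have "stick_breaking (snd x) i = z i" if "i < m" for i
      using fun_cong[OF x(2), of i] that by (simp add: tr_def)
    then show False using x(1) D(3) by (auto simp: R_def F_def)
  qed
  have "\<forall>\<^sub>F n in sequentially. \<forall>x\<in>D.
      (\<integral>\<^sup>+u'. emeasure (W_kernel (\<beta> n) (stick_breaking u')) (B x) * indicator (A x) u' \<partial>U_law (\<alpha> n))
      \<le> ennreal (exp (- \<gamma> n * r))"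
    using D AB unfolding bnd_def by (intro eventually_ball_finite) auto
  then have "\<forall>\<^sub>F n in sequentially. measure (Q_law (\<alpha> n) (\<beta> n)) (N \<inter> infinite_simplex) \<le> card D * exp (- \<gamma> n * r)"
  proof eventually_elim
    case (elim n)
    interpret prob_space "Q_law (\<alpha> n) (\<beta> n)" by (rule prob_space_Q_law)
    have [measurable]: "A x \<in> sets borel" "B x \<in> sets borel" if "x \<in> D" for x
      using AB[of x] D(1) that by (auto intro!: borel_open)
    have kernel: "emeasure (W_kernel (\<beta> n) (stick_breaking u)) {w. stick_breaking w \<in> N}
      \<le> (\<Sum>x\<in>D. emeasure (W_kernel (\<beta> n) (stick_breaking u)) (B x) * indicator (A x) u)" if u: "u \<in> E" for u
    proof -
      \<comment> \<open>\<open>?B x\<close> is the slice at \<open>u\<close> of the covering box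
        \<open>A x \<times> B x\<close>.\<close>
      let ?W = "W_kernel (\<beta> n) (stick_breaking u)" and ?B = "\<lambda>x. if u \<in> A x then B x else {}"
      have "emeasure ?W {w. stick_breaking w \<in> N} \<le> emeasure ?W (\<Union>x\<in>D. ?B x)"
      proof (rule emeasure_mono_AE)
        show "AE w in ?W. w \<in> {w. stick_breaking w \<in> N} \<longrightarrow> w \<in> (\<Union>x\<in>D. ?B x)"
          using AE_W_kernel[of "\<beta> n" "stick_breaking u"]
        proof eventually_elim
          case (elim w)
          then have "(u, w) \<in> E \<times> E" using u by (auto simp: E_def)
          then have "(u, w) \<in> R \<or> (\<exists>x\<in>D. u \<in> A x \<and> w \<in> B x)" by (auto simp: R_def)
          moreover have "stick_breaking w \<notin> N" if "(u, w) \<in> R"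
            using that by (force simp: N_def)
          ultimately show ?case by (auto split: if_splits)
        qed
      qed (auto intro!: sets.finite_UN D)
      also have "\<dots> \<le> (\<Sum>x\<in>D. emeasure ?W (?B x))"
        using D by (intro emeasure_subadditive_finite) auto
      also have "\<dots> = (\<Sum>x\<in>D. emeasure ?W (B x) * indicator (A x) u)"
        by (intro sum.cong) (auto simp: indicator_def)
      finally show ?thesis .
    qed
    have meas: "(\<lambda>u. emeasure (W_kernel (\<beta> n) (stick_breaking u)) (B x) * indicator (A x) u)
        \<in> borel_measurable (U_law (\<alpha> n))" if "x \<in> D" for x
      unfolding measurable_cong_sets[OF sets_U_law refl]
      using that by (intro borel_measurable_times_ennreal W_kernel_stick_breaking_measurable borel_measurable_indicator) auto
    have "emeasure (Q_law (\<alpha> n) (\<beta> n)) (N \<inter> infinite_simplex) =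
        (\<integral>\<^sup>+u. emeasure (W_kernel (\<beta> n) (stick_breaking u)) {w. stick_breaking w \<in> N} \<partial>U_law (\<alpha> n))"
      by (rule emeasure_Q_law) (use N in simp)
    also have "\<dots> \<le> (\<integral>\<^sup>+u. (\<Sum>x\<in>D. emeasure (W_kernel (\<beta> n) (stick_breaking u)) (B x) * indicator (A x) u) \<partial>U_law (\<alpha> n))"
      using AE_U_law_interior[OF pos(1)]
      by (intro nn_integral_mono_AE, eventually_elim) (auto intro!: kernel simp: E_def less_imp_le)
    also have "\<dots> = (\<Sum>x\<in>D. \<integral>\<^sup>+u. emeasure (W_kernel (\<beta> n) (stick_breaking u)) (B x) * indicator (A x) u \<partial>U_law (\<alpha> n))"
      by (rule nn_integral_sum[OF meas])
    also have "\<dots> \<le> (\<Sum>x\<in>D. ennreal (exp (- \<gamma> n * r)))" using elim by (intro sum_mono) auto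
    also have "\<dots> = ennreal (card D * exp (- \<gamma> n * r))" by (simp add: ennreal_mult ennreal_of_nat_eq_real_of_nat)
    finally show ?case by (simp add: emeasure_eq_measure)
  qed
  then show ?thesis using that N zN by blast
qed

end

section \<open>Lower bound\<close>

text \<open>The real-valued form of \<open>h\<close>. It is correct on the boundary wherever
  \<open>h\<close> is finite, because a factor 0 annihilates the junk value of the
  logarithm.\<close>

definition relative_entropy :: "real \<Rightarrow> real \<Rightarrow> real" where
  "relative_entropy u w = u * ln (u / w) + (1 - u) * ln ((1 - u) / (1 - w))"

text \<open>The point is uniformity: one constant and one threshold serve all proportions near
  \<open>u\<close> and all large \<beta>, so the kernel can be bounded below on a whole box of
  proportions.\<close>

lemma beta_distribution_local_lower_bound:
  fixes u :: "nat \<Rightarrow> real" and i :: nat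
  assumes u: "\<And>j. j \<le> i \<Longrightarrow> 0 < u j \<and> u j < 1" and w: "0 < w" "w < 1" and d: "0 < \<delta>"
    and r: "(\<Prod>j<i. 1 - u j) * relative_entropy (u i) w < r"
  obtains \<kappa> \<beta>0 where "0 < \<kappa>"
    "\<forall>\<^sub>F x in nhds u. \<forall>\<beta>\<ge>\<beta>0. \<kappa> * exp (- \<beta> * r) \<le>
      measure (beta_distribution (\<beta> * (\<Prod>j<i. 1 - x j) * x i) (\<beta> * (\<Prod>j<i. 1 - x j) * (1 - x i))) {w - \<delta><..<w + \<delta>}"
proof -
  define T where "T x = (\<Prod>j<i. 1 - x j)" for x :: "nat \<Rightarrow> real"
  \<comment> \<open>\<open>\<beta> * f e x\<close> is the logarithm of the bound of
    \<open>beta_distribution_interval_ge\<close> on the interval of radius \<open>e\<close> around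
    \<open>w\<close>, without the width \<open>2 * e\<close>.\<close>
  define f where "f e x = T x * (x i * ln (w - e) + (1 - x i) * ln (1 - w - e)
      - (1 - e) * (x i * ln (x i) + (1 - x i) * ln (1 - x i)))" for e and x :: "nat \<Rightarrow> real"
  have ui: "0 < u i" "u i < 1" using u by auto
  have Tu: "0 < T u" unfolding T_def using u by (auto intro!: prod_pos)
  have "((\<lambda>e. f e u) \<longlongrightarrow> T u * (u i * ln (w - 0) + (1 - u i) * ln (1 - w - 0)
      - (1 - 0) * (u i * ln (u i) + (1 - u i) * ln (1 - u i)))) (at_right 0)"
    unfolding f_def by (intro tendsto_intros) (use w in auto)
  also have "T u * (u i * ln (w - 0) + (1 - u i) * ln (1 - w - 0)
      - (1 - 0) * (u i * ln (u i) + (1 - u i) * ln (1 - u i))) = - (T u * relative_entropy (u i) w)"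
    using ui w by (simp add: relative_entropy_def ln_div algebra_simps)
  finally have "\<forall>\<^sub>F e in at_right 0. - r < f e u"
    using r by (intro order_tendstoD(1)) (auto simp: T_def)
  moreover have "\<forall>\<^sub>F e in at_right 0. e \<in> {0<..<min (min w (1 - w)) \<delta>}"
    using w d by (intro eventually_at_right_real) auto
  ultimately have "\<forall>\<^sub>F e in at_right 0. - r < f e u \<and> e \<in> {0<..<min (min w (1 - w)) \<delta>}"
    by (rule eventually_conj)
  then obtain e where e: "- r < f e u" "0 < e" "e < w" "e < 1 - w" "e < \<delta>"
    by (auto dest!: eventually_happens)
  have Tt: "(T \<longlongrightarrow> T u) (nhds u)" unfolding T_def by (intro tendsto_intros tendsto_coordinate)
  \<comment> \<open>\<open>\<beta> * \<eta>\<close> bounds both Beta parameters from below near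
    \<open>u\<close>, so \<beta> at least \<open>1 / (e * \<eta>)\<close> supplies the hypotheses
    \<open>1 \<le> e * A\<close> and \<open>1 \<le> e * B\<close>.\<close>
  define \<eta> where "\<eta> = min (T u * u i) (T u * (1 - u i)) / 2"
  have \<eta>: "0 < \<eta>" "\<eta> < T u * u i" "\<eta> < T u * (1 - u i)"
    using Tu ui by (auto simp: \<eta>_def min_def field_simps)
  have "(f e \<longlongrightarrow> f e u) (nhds u)"
    unfolding f_def by (intro tendsto_intros Tt tendsto_coordinate) (use ui in auto)
  then have "\<forall>\<^sub>F x in nhds u. - r < f e x" using e(1) by (rule order_tendstoD)
  moreover have "\<forall>\<^sub>F x in nhds u. \<eta> < T x * x i" "\<forall>\<^sub>F x in nhds u. \<eta> < T x * (1 - x i)"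
    using \<eta> by (auto intro!: order_tendstoD(1) tendsto_intros Tt tendsto_coordinate)
  moreover have "\<forall>\<^sub>F x in nhds u. 0 < x i" "\<forall>\<^sub>F x in nhds u. x i < 1"
    using ui tendsto_coordinate[of i u] by (auto intro: order_tendstoD)
  ultimately have "\<forall>\<^sub>F x in nhds u. \<forall>\<beta>\<ge>1 / (e * \<eta>). (2 * e) * exp (- \<beta> * r) \<le>
      measure (beta_distribution (\<beta> * (\<Prod>j<i. 1 - x j) * x i) (\<beta> * (\<Prod>j<i. 1 - x j) * (1 - x i))) {w - \<delta><..<w + \<delta>}"
  proof eventually_elim
    case (elim x)
    show ?case
    proof (intro allI impI)
      fix \<beta> assume \<beta>: "1 / (e * \<eta>) \<le> \<beta>"
      have e\<eta>: "0 < e * \<eta>" using e \<eta> by simp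
      then have b1: "1 \<le> e * (\<beta> * \<eta>)" using \<beta> by (simp add: field_simps)
      have \<beta>0: "0 < \<beta>" using \<beta> e\<eta> by (meson less_le_trans zero_less_divide_1_iff)
      let ?A = "\<beta> * T x * x i" and ?B = "\<beta> * T x * (1 - x i)"
      interpret prob_space "beta_distribution ?A ?B" by (rule prob_space_beta_distribution)
      have "\<beta> * \<eta> < \<beta> * (T x * x i)" "\<beta> * \<eta> < \<beta> * (T x * (1 - x i))" using elim \<beta>0 by auto
      then have AB: "\<beta> * \<eta> < ?A" "\<beta> * \<eta> < ?B" by (simp_all add: mult.assoc)
      have b\<eta>: "0 < \<beta> * \<eta>" using \<beta>0 \<eta> by simp
      have AB0: "0 < ?A" "0 < ?B" using AB b\<eta> by linarith+
      have "e * (\<beta> * \<eta>) \<le> e * ?A" "e * (\<beta> * \<eta>) \<le> e * ?B" using AB e by auto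
      then have AB1: "1 \<le> e * ?A" "1 \<le> e * ?B" using b1 by linarith+
      have "?A + ?B = \<beta> * T x" by (simp add: algebra_simps)
      moreover have "\<beta> * T x \<noteq> 0" using AB0 by auto
      ultimately have mean: "x i = ?A / (?A + ?B)" by simp
      let ?M = "(x i powr ?A * (1 - x i) powr ?B) powr (1 - e)"
      have pw: "y powr ?A * z powr ?B = exp (?A * ln y + ?B * ln z)" if "0 < y" "0 < z" for y z
        using that by (simp add: powr_def exp_add)
      have "((w - e) powr ?A * (1 - (w + e)) powr ?B) / ?M
        = exp (?A * ln (w - e) + ?B * ln (1 - (w + e))) / exp (?A * ln (x i) + ?B * ln (1 - x i)) powr (1 - e)"
        using e elim by (subst (1 2) pw) auto
      also have "\<dots> = exp (?A * ln (w - e) + ?B * ln (1 - (w + e)) - (1 - e) * (?A * ln (x i) + ?B * ln (1 - x i)))"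
        unfolding exp_powr_real exp_diff by (simp only: mult.commute)
      also have "\<dots> = exp (\<beta> * f e x)"
        unfolding f_def by (rule arg_cong[where f = exp]) (simp add: algebra_simps)
      finally have eq: "((w - e) powr ?A * (1 - (w + e)) powr ?B) / ?M = exp (\<beta> * f e x)" .
      have "(2 * e) * exp (- \<beta> * r) \<le> (2 * e) * exp (\<beta> * f e x)"
      proof -
        have "\<beta> * (- r) \<le> \<beta> * f e x" using elim(1) \<beta>0 by (intro mult_left_mono) auto
        then show ?thesis using e by simp
      qed
      also have "\<dots> = (w + e - (w - e)) * ((w - e) powr ?A * (1 - (w + e)) powr ?B) / ?M"
        by (simp only: eq[symmetric]) simp
      also have "\<dots> \<le> prob {w - e<..<w + e}"
        using e w by (intro beta_distribution_interval_ge AB0 AB1 mean) auto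
      also have "\<dots> \<le> prob {w - \<delta><..<w + \<delta>}"
        using e by (intro finite_measure_mono) auto
      finally show "(2 * e) * exp (- \<beta> * r) \<le>
      measure (beta_distribution (\<beta> * (\<Prod>j<i. 1 - x j) * x i) (\<beta> * (\<Prod>j<i. 1 - x j) * (1 - x i))) {w - \<delta><..<w + \<delta>}"
        unfolding T_def .
    qed
  qed
  then show ?thesis using e by (intro that[of "2 * e"]) auto
qed

context scaled_parameters
begin

lemma joint_box_lower_bound:
  assumes uw: "\<And>i. 0 < u i \<and> u i < 1" "\<And>i. 0 < w i \<and> w i < 1" and d: "0 < \<delta>"
    and r: "(\<Sum>i<m. a * ln (1 / (1 - u i)) + b * (\<Prod>j<i. 1 - u j) * relative_entropy (u i) (w i)) < r"
  shows "\<forall>\<^sub>F n in sequentially. ennreal (exp (- \<gamma> n * r)) \<le>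
    (\<integral>\<^sup>+x. emeasure (W_kernel (\<beta> n) (stick_breaking x)) {y. \<forall>i<m. y i \<in> {w i - \<delta><..<w i + \<delta>}} \<partial>U_law (\<alpha> n))"
proof -
  define L where "L i = ln (1 / (1 - u i))" for i
  define H where "H i = (\<Prod>j<i. 1 - u j) * relative_entropy (u i) (w i)" for i
  \<comment> \<open>Raising each \<open>H i\<close> by \<open>e\<close> costs
    \<open>e * (b * m)\<close> in total; the \<open>+ 1\<close> keeps the remaining slack strict and
    covers \<open>m = 0\<close>.\<close>
  define e where "e = (r - (\<Sum>i<m. a * L i + b * H i)) / (b * m + 1)"
  have bm: "0 < b * m + 1" using pos by (simp add: add_nonneg_pos)
  have e: "0 < e" using r bm by (simp add: e_def L_def H_def mult.assoc)
  have "e * (b * m + 1) = r - (\<Sum>i<m. a * L i + b * H i)" using bm by (simp add: e_def)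
  moreover have "(\<Sum>i<m. a * L i + b * (H i + e)) = (\<Sum>i<m. a * L i + b * H i) + e * (b * m)"
    by (simp add: sum.distrib algebra_simps)
  ultimately have slack: "(\<Sum>i<m. a * L i + b * (H i + e)) < r" using e by (simp add: algebra_simps)
  let ?meas = "\<lambda>i \<beta> x. measure (beta_distribution (\<beta> * (\<Prod>j<i. 1 - x j) * x i) (\<beta> * (\<Prod>j<i. 1 - x j) * (1 - x i))) {w i - \<delta><..<w i + \<delta>}"
  define Lb where "Lb i \<kappa> \<beta>0 \<longleftrightarrow> 0 < \<kappa> \<and> (\<forall>\<^sub>F x in nhds u. \<forall>\<beta>\<ge>\<beta>0. \<kappa> * exp (- \<beta> * (H i + e)) \<le> ?meas i \<beta> x)"
    for i and \<kappa> \<beta>0 :: real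
  have "\<exists>\<kappa> \<beta>0. Lb i \<kappa> \<beta>0" for i
  proof -
    have X: "(\<Prod>j<i. 1 - u j) * relative_entropy (u i) (w i) < H i + e" using e unfolding H_def by linarith
    obtain \<kappa> \<beta>0 where kb: "0 < \<kappa>" "\<forall>\<^sub>F x in nhds u. \<forall>\<beta>\<ge>\<beta>0. \<kappa> * exp (- \<beta> * (H i + e)) \<le> ?meas i \<beta> x"
      using beta_distribution_local_lower_bound[OF uw(1) conjunct1[OF uw(2)] conjunct2[OF uw(2)] d X] .
    show ?thesis unfolding Lb_def by (intro exI conjI) (rule kb)+
  qed
  then obtain \<kappa> \<beta>0 where Lb: "\<And>i. Lb i (\<kappa> i) (\<beta>0 i)" by metis
  then have \<kappa>: "0 < \<kappa> i" "\<forall>\<^sub>F x in nhds u. \<forall>\<beta>\<ge>\<beta>0 i. \<kappa> i * exp (- \<beta> * (H i + e)) \<le> ?meas i \<beta> x" for i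
    unfolding Lb_def by blast+
  have ev0: "\<forall>\<^sub>F x in nhds u. \<forall>i\<in>{..<m}. \<forall>\<beta>\<ge>\<beta>0 i. \<kappa> i * exp (- \<beta> * (H i + e)) \<le> ?meas i \<beta> x"
    by (intro eventually_ball_finite ballI \<kappa>) simp
  obtain \<eta> M where \<eta>: "0 < \<eta>" "\<forall>x. (\<forall>i<M. \<bar>x i - u i\<bar> < \<eta>) \<longrightarrow>
      (\<forall>i\<in>{..<m}. \<forall>\<beta>\<ge>\<beta>0 i. \<kappa> i * exp (- \<beta> * (H i + e)) \<le> ?meas i \<beta> x)"
    using eventually_nhds_cylinder[OF ev0] by (elim exE conjE) (rule that)
  have box: "\<kappa> i * exp (- \<beta> * (H i + e)) \<le> ?meas i \<beta> x"
    if "\<And>i. i < m \<Longrightarrow> \<bar>x i - u i\<bar> < \<eta>" "i < m" "\<beta> \<ge> \<beta>0 i" for x i \<beta>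
  proof -
    \<comment> \<open>The neighbourhood may restrict coordinates beyond \<open>m\<close>, on which
      the estimate does not depend; they are reset to those of \<open>u\<close>.\<close>
    have "\<forall>i\<in>{..<m}. \<forall>\<beta>\<ge>\<beta>0 i. \<kappa> i * exp (- \<beta> * (H i + e)) \<le> ?meas i \<beta> (\<lambda>i. if i < m then x i else u i)"
      using that(1) \<eta>(1) by (intro \<eta>(2)[THEN spec, THEN mp]) auto
    then show ?thesis using that(2,3) by simp
  qed
  \<comment> \<open>The interval lies to the right of \<open>u i\<close>: for large \<alpha> the
    tail beyond \<open>u i\<close> concentrates next to \<open>u i\<close>, and the part beyond
    \<open>k i\<close> is at most half of it.\<close>
  define k where "k i = u i + min \<eta> (1 - u i) / 2" for i
  define I where "I i = {u i<..<k i + min \<eta> (1 - u i) / 2}" for i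
  have k: "u i < k i" "k i < 1" for i using uw(1)[of i] \<eta> by (auto simp: k_def min_def field_simps)
  have I: "\<bar>x - u i\<bar> < \<eta>" if "x \<in> I i" for x i
    using that \<eta>(1) by (auto simp: I_def k_def min_def split: if_splits)
  define K where "K = (\<Prod>i<m. \<kappa> i / 2)"
  have K: "0 < K" using \<kappa>(1) by (auto simp: K_def intro!: prod_pos)
  define \<sigma> where "\<sigma> n = \<alpha> n * (\<Sum>i<m. L i) + \<beta> n * (\<Sum>i<m. H i + e)" for n
  have "(\<lambda>n. \<sigma> n / \<gamma> n) \<longlonglongrightarrow> a * (\<Sum>i<m. L i) + b * (\<Sum>i<m. H i + e)"
    unfolding \<sigma>_def by (rule exponent_tendsto)
  \<comment> \<open>The gap between \<open>r'\<close> and \<open>r\<close> absorbs the constant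
    \<open>K\<close> once \<gamma> is large.\<close>
  moreover obtain r' where r': "(\<Sum>i<m. a * L i + b * (H i + e)) < r'" "r' < r" using slack dense by blast
  moreover have "(\<Sum>i<m. a * L i + b * (H i + e)) = a * (\<Sum>i<m. L i) + b * (\<Sum>i<m. H i + e)"
    by (simp only: sum.distrib[of "\<lambda>i. a * L i"] sum_distrib_left)
  ultimately have ev1: "\<forall>\<^sub>F n in sequentially. \<sigma> n / \<gamma> n < r'" by (metis order_tendstoD(2))
  have ev2: "\<forall>\<^sub>F n in sequentially. - ln K / (r - r') < \<gamma> n"
    using filterlim_at_top_dense[THEN iffD1, OF at_top(3)] by blast
  have ev3: "\<forall>\<^sub>F n in sequentially. \<forall>i\<in>{..<m}. \<beta>0 i \<le> \<beta> n"
    using filterlim_at_top[THEN iffD1, OF at_top(2)] by (intro eventually_ball_finite) auto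
  have ev4: "\<forall>\<^sub>F n in sequentially. \<forall>i\<in>{..<m}. (1 - k i) powr \<alpha> n \<le> (1 - u i) powr \<alpha> n / 2"
  proof (intro eventually_ball_finite ballI)
    fix i
    define \<rho> where "\<rho> = (1 - k i) / (1 - u i)"
    have \<rho>: "0 < \<rho>" "\<rho> < 1" using k[of i] uw(1)[of i] by (auto simp: \<rho>_def)
    have "\<forall>\<^sub>F n in sequentially. ln 2 / - ln \<rho> < \<alpha> n"
      using filterlim_at_top_dense[THEN iffD1, OF at_top(1)] by blast
    then show "\<forall>\<^sub>F n in sequentially. (1 - k i) powr \<alpha> n \<le> (1 - u i) powr \<alpha> n / 2"
    proof eventually_elim
      case (elim n)
      have "- ln \<rho> > 0" using \<rho> by simp
      then have "ln 2 < \<alpha> n * - ln \<rho>" using elim by (subst (asm) pos_divide_less_eq)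
      then have "exp (\<alpha> n * ln \<rho>) \<le> exp (- ln 2)" by simp
      then have "\<rho> powr \<alpha> n \<le> 1 / 2" using \<rho> by (simp add: powr_def exp_minus)
      moreover have "1 - k i = \<rho> * (1 - u i)" using uw(1)[of i] by (simp add: \<rho>_def)
      ultimately show ?case
        using \<rho> uw(1)[of i] mult_right_mono[of "\<rho> powr \<alpha> n" "1/2" "(1 - u i) powr \<alpha> n"]
        by (simp add: powr_mult)
    qed
  qed simp
  from ev1 ev2 ev3 ev4 show ?thesis
  proof eventually_elim
    case (elim n)
    let ?X = "{x. \<forall>i<m. x i \<in> I i}" and ?Y = "{y. \<forall>i<m. y i \<in> {w i - \<delta><..<w i + \<delta>}}"
    define C where "C = ennreal (\<Prod>i<m. \<kappa> i * exp (- \<beta> n * (H i + e)))"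
    have X: "?X \<in> sets (U_law (\<alpha> n))"
      unfolding sets_U_law
      unfolding I_def greaterThanLessThan_iff
      by (intro borel_open open_Collect_cylinder open_Collect_conj open_Collect_less continuous_intros
          continuous_on_product_coordinates)
    have fin: "emeasure (beta_distribution p q) Z = ennreal (measure (beta_distribution p q) Z)" for p q Z
      by (intro finite_measure.emeasure_eq_measure prob_space.finite_measure prob_space_beta_distribution)
    have kernel: "C \<le> emeasure (W_kernel (\<beta> n) (stick_breaking x)) ?Y" if x: "x \<in> ?X" for x
    proof -
      have "\<kappa> i * exp (- \<beta> n * (H i + e)) \<le> ?meas i (\<beta> n) x" if "i < m" for i
        using x I elim(3) that by (intro box) auto
      then show ?thesis
        unfolding C_def using \<kappa>(1)
        by (subst emeasure_W_kernel_cylinder)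
           (auto simp: fin prod_ennreal less_imp_le intro!: ennreal_leI prod_mono)
    qed
    have "ennreal (\<Prod>i<m. exp (- \<alpha> n * L i) / 2) \<le> emeasure (U_law (\<alpha> n)) ?X"
    proof -
      have "exp (- \<alpha> n * L i) / 2 \<le> measure (beta_distribution 1 (\<alpha> n)) (I i)" if "i < m" for i
      proof -
        have "(1 - u i) powr \<alpha> n - (1 - k i) powr \<alpha> n \<le> measure (beta_distribution 1 (\<alpha> n)) (I i)"
          unfolding I_def using k[of i] uw(1)[of i] \<eta>(1) pos(1)
          by (intro beta_distribution_1_interval) auto
        moreover have "exp (- \<alpha> n * L i) = (1 - u i) powr \<alpha> n"
          using uw(1)[of i] by (simp add: L_def powr_def ln_div)
        ultimately show ?thesis using elim(4) that by force
      qed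
      then show ?thesis
        by (subst emeasure_U_law_cylinder)
           (auto simp: I_def fin prod_ennreal intro!: ennreal_leI prod_mono)
    qed
    then have "C * ennreal (\<Prod>i<m. exp (- \<alpha> n * L i) / 2) \<le> C * emeasure (U_law (\<alpha> n)) ?X"
      by (rule mult_left_mono) simp
    also have "\<dots> = (\<integral>\<^sup>+x. C * indicator ?X x \<partial>U_law (\<alpha> n))"
      by (rule nn_integral_cmult_indicator[OF X, symmetric])
    also have "\<dots> \<le> (\<integral>\<^sup>+x. emeasure (W_kernel (\<beta> n) (stick_breaking x)) ?Y \<partial>U_law (\<alpha> n))"
      using kernel by (intro nn_integral_mono) (auto simp: indicator_def)
    finally have ge: "C * ennreal (\<Prod>i<m. exp (- \<alpha> n * L i) / 2)
      \<le> (\<integral>\<^sup>+x. emeasure (W_kernel (\<beta> n) (stick_breaking x)) ?Y \<partial>U_law (\<alpha> n))" .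
    have "C * ennreal (\<Prod>i<m. exp (- \<alpha> n * L i) / 2)
      = ennreal (\<Prod>i<m. (\<kappa> i * exp (- \<beta> n * (H i + e))) * (exp (- \<alpha> n * L i) / 2))"
      unfolding C_def prod.distrib[of "\<lambda>i. \<kappa> i * exp (- \<beta> n * (H i + e))"]
      using \<kappa>(1) by (intro ennreal_mult'[symmetric] prod_nonneg) (auto simp: less_imp_le)
    also have "(\<Prod>i<m. (\<kappa> i * exp (- \<beta> n * (H i + e))) * (exp (- \<alpha> n * L i) / 2))
      = (\<Prod>i<m. (\<kappa> i / 2) * exp (- (\<alpha> n * L i + \<beta> n * (H i + e))))"
      by (intro prod.cong) (simp_all add: exp_add[symmetric] algebra_simps)
    also have "\<dots> = K * exp (\<Sum>i<m. - (\<alpha> n * L i + \<beta> n * (H i + e)))"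
      unfolding K_def exp_sum[OF finite_lessThan] by (rule prod.distrib)
    also have "(\<Sum>i<m. - (\<alpha> n * L i + \<beta> n * (H i + e))) = - \<sigma> n"
      by (simp only: sum_negf \<sigma>_def sum.distrib[of "\<lambda>i. \<alpha> n * L i"] sum_distrib_left)
    finally have C_eq: "C * ennreal (\<Prod>i<m. exp (- \<alpha> n * L i) / 2) = ennreal (K * exp (- \<sigma> n))" .
    have "\<sigma> n < r' * \<gamma> n" using elim(1) pos(3)[of n] by (simp add: pos_divide_less_eq)
    moreover have "- ln K < \<gamma> n * (r - r')" using elim(2) r' by (subst (asm) pos_divide_less_eq) auto
    ultimately have "- \<gamma> n * r \<le> ln K - \<sigma> n" by (simp add: algebra_simps)
    then have "exp (- \<gamma> n * r) \<le> exp (ln K - \<sigma> n)" by simp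
    also have "\<dots> = K * exp (- \<sigma> n)" using K by (simp add: exp_diff exp_minus divide_inverse)
    finally show ?case using ge unfolding C_eq by (meson ennreal_leI order_trans)
  qed
qed

end

section \<open>Approximation by interior points\<close>

lemma xlog_eq_ereal: "(y = 0 \<Longrightarrow> x = 0) \<Longrightarrow> xlog x y = ereal (x * ln (x / y))"
  by (simp add: xlog_def)

text \<open>Points of finite cost may lie on the boundary of the cube, where the densities degenerate;
  moving vanishing coordinates to \<open>e > 0\<close> changes the cost continuously.\<close>

lemma cost_interior_approximation:
  assumes pos: "0 < a" "0 < b"
    and uw: "\<And>i. i < m \<Longrightarrow> 0 \<le> u i \<and> u i < 1 \<and> 0 \<le> w i \<and> w i \<le> 1"
    and cost: "cost a b m u w < ereal r" and \<delta>: "0 < \<delta>"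
  obtains u' w' where "\<And>i. 0 < u' i \<and> u' i < 1" "\<And>i. 0 < w' i \<and> w' i < 1"
    "(\<Sum>i<m. a * ln (1 / (1 - u' i)) + b * (\<Prod>j<i. 1 - u' j) * relative_entropy (u' i) (w' i)) < r"
    "\<And>i. i < m \<Longrightarrow> \<bar>stick_breaking w' i - stick_breaking w i\<bar> < \<delta>"
proof -
  let ?T = "\<lambda>u i. \<Prod>j<i. 1 - (u::nat \<Rightarrow> real) j"
  have T: "0 < ?T u i" if "i < m" for i using uw that by (auto intro!: prod_pos)
  \<comment> \<open>Since \<open>u i < 1\<close>, finite cost rules out \<open>w i = 1\<close>, so
    the only boundary value left for either coordinate is 0.\<close>
  have fin: "w i < 1 \<and> (w i = 0 \<longrightarrow> u i = 0)" if i: "i < m" for i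
  proof -
    have "cost a b m u w \<noteq> \<infinity>" using cost by auto
    then have "ereal (a * ln (1 / (1 - u i))) + ereal (b * ?T u i) * h (u i) (w i) \<noteq> \<infinity>"
      using i by (auto simp: cost_def sum_Pinfty)
    moreover have "0 < b * ?T u i" using T[OF i] pos by simp
    ultimately have "h (u i) (w i) \<noteq> \<infinity>" by auto
    then have "xlog (u i) (w i) \<noteq> \<infinity>" "xlog (1 - u i) (1 - w i) \<noteq> \<infinity>" by (auto simp: h_def)
    then show ?thesis using uw[OF i] by (force simp: xlog_def split: if_splits)
  qed
  have h_eq: "h (u i) (w i) = ereal (relative_entropy (u i) (w i))" if "i < m" for i
  proof -
    have "xlog (u i) (w i) = ereal (u i * ln (u i / w i))"
      "xlog (1 - u i) (1 - w i) = ereal ((1 - u i) * ln ((1 - u i) / (1 - w i)))"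
      using fin[OF that] by (auto intro!: xlog_eq_ereal)
    then show ?thesis by (simp add: h_def relative_entropy_def)
  qed
  have cost_eq: "cost a b m u w = ereal (\<Sum>i<m. a * ln (1 / (1 - u i)) + b * ?T u i * relative_entropy (u i) (w i))"
    unfolding cost_def sum_ereal[symmetric] by (intro sum.cong) (auto simp: h_eq)
  \<comment> \<open>Coordinates from \<open>m\<close> on are irrelevant to the cost; 1/2 merely puts
    them in the interior.\<close>
  define v where "v e x i = (if i < m then if x i = 0 then e else x i else 1 / 2)" for e and x :: "nat \<Rightarrow> real" and i :: nat
  have v_lim: "((\<lambda>e. v e x i) \<longlongrightarrow> x i) (at_right 0)" if "i < m" for x i
    unfolding v_def using that by (cases "x i = 0") (auto intro: tendsto_ident_at)
  have T_lim: "((\<lambda>e. ?T (v e x) i) \<longlongrightarrow> ?T x i) (at_right 0)" if "i < m" for x i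
    using that by (intro tendsto_prod tendsto_diff tendsto_const v_lim) auto
  have D_lim: "((\<lambda>e. relative_entropy (v e u i) (v e w i)) \<longlongrightarrow> relative_entropy (u i) (w i)) (at_right 0)"
    if i: "i < m" for i
  proof -
    consider "u i \<noteq> 0" "w i \<noteq> 0" | "u i = 0" "w i = 0" | "u i = 0" "w i \<noteq> 0"
      using fin[OF i] by blast
    then show ?thesis
    proof cases
      case 1
      then show ?thesis using i by (simp add: v_def)
    next
      case 2
      \<comment> \<open>Moving both vanishing coordinates to the same \<open>e\<close> keeps the
        relative entropy at 0.\<close>
      have "\<forall>\<^sub>F e in at_right 0. e \<in> {0<..<1::real}" by (rule eventually_at_right_real) simp
      then have "\<forall>\<^sub>F e in at_right 0. relative_entropy (v e u i) (v e w i) = 0"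
        by eventually_elim (use 2 i in \<open>auto simp: relative_entropy_def v_def\<close>)
      then show ?thesis using 2 by (intro tendsto_eventually) (simp add: relative_entropy_def)
    next
      case 3
      define y where "y = w i"
      have y: "0 < y" "y < 1" using 3 uw[OF i] fin[OF i] by (auto simp: y_def)
      have "((\<lambda>e. e * ln (e / y) + (1 - e) * ln ((1 - e) / (1 - y))) \<longlongrightarrow> ln (1 / (1 - y))) (at_right 0)"
        using y by (real_asymp simp: field_simps)
      then show ?thesis using 3 i by (simp add: relative_entropy_def v_def y_def)
    qed
  qed
  have L_lim: "((\<lambda>e. ln (1 / (1 - v e u i))) \<longlongrightarrow> ln (1 / (1 - u i))) (at_right 0)" if "i < m" for i
    using uw[OF that] by (intro tendsto_ln tendsto_divide tendsto_diff tendsto_const v_lim that) auto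
  have "((\<lambda>e. \<Sum>i<m. a * ln (1 / (1 - v e u i)) + b * ?T (v e u) i * relative_entropy (v e u i) (v e w i))
    \<longlongrightarrow> (\<Sum>i<m. a * ln (1 / (1 - u i)) + b * ?T u i * relative_entropy (u i) (w i))) (at_right 0)"
    by (intro tendsto_sum tendsto_add tendsto_mult tendsto_const L_lim T_lim D_lim) auto
  then have ev1: "\<forall>\<^sub>F e in at_right 0. (\<Sum>i<m. a * ln (1 / (1 - v e u i)) + b * ?T (v e u) i * relative_entropy (v e u i) (v e w i)) < r"
    using cost unfolding cost_eq by (intro order_tendstoD(2)) auto
  have ev2: "\<forall>\<^sub>F e in at_right 0. e \<in> {0<..<1::real}" by (rule eventually_at_right_real) simp
  have S_lim: "((\<lambda>e. stick_breaking (v e w) i) \<longlongrightarrow> stick_breaking w i) (at_right 0)" if "i < m" for i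
    unfolding stick_breaking_def by (intro tendsto_mult T_lim v_lim that)
  have ev3: "\<forall>\<^sub>F e in at_right 0. \<forall>i\<in>{..<m}. \<bar>stick_breaking (v e w) i - stick_breaking w i\<bar> < \<delta>"
    using tendstoD[OF S_lim \<delta>] by (intro eventually_ball_finite) (auto simp: dist_real_def)
  have "\<forall>\<^sub>F e in at_right 0. e \<in> {0<..<1::real} \<and>
     (\<Sum>i<m. a * ln (1 / (1 - v e u i)) + b * ?T (v e u) i * relative_entropy (v e u i) (v e w i)) < r \<and>
     (\<forall>i\<in>{..<m}. \<bar>stick_breaking (v e w) i - stick_breaking w i\<bar> < \<delta>)"
    using ev2 ev1 ev3 by eventually_elim auto
  then obtain e where e: "0 < e" "e < 1"
     "(\<Sum>i<m. a * ln (1 / (1 - v e u i)) + b * ?T (v e u) i * relative_entropy (v e u i) (v e w i)) < r"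
     "\<forall>i\<in>{..<m}. \<bar>stick_breaking (v e w) i - stick_breaking w i\<bar> < \<delta>"
    by (auto dest!: eventually_happens)
  show ?thesis
  proof
    show "0 < v e u i \<and> v e u i < 1" for i using uw[of i] e by (auto simp: v_def order_less_le)
    show "0 < v e w i \<and> v e w i < 1" for i using uw[of i] fin[of i] e by (auto simp: v_def order_less_le)
  qed (use e in auto)
qed

context scaled_parameters
begin

text \<open>A near-optimal point of the fibre is moved into the interior. Its image leaves
  \<open>z\<close>, but by less than the tolerance of a cylinder inside \<open>G\<close>.\<close>

lemma Q_law_local_lower_bound:
  assumes G: "open G" "z \<in> G"
    and z: "\<And>m. Inf {cost a b m u w | u w.
      (\<forall>i<m. 0 \<le> u i \<and> u i < 1 \<and> 0 \<le> w i \<and> w i \<le> 1) \<and> (\<forall>i<m. stick_breaking w i = z i)} < ereal r \<or> m = 0"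
  shows "\<forall>\<^sub>F n in sequentially. exp (- \<gamma> n * r) \<le> measure (Q_law (\<alpha> n) (\<beta> n)) (G \<inter> infinite_simplex)"
proof -
  have evG: "\<forall>\<^sub>F x in nhds z. x \<in> G" using G by (rule eventually_nhds_in_open)
  obtain e M where e: "0 < e" "\<forall>x. (\<forall>i<M. \<bar>x i - z i\<bar> < e) \<longrightarrow> x \<in> G"
    using eventually_nhds_cylinder[OF evG] by (elim exE conjE) (rule that)
  \<comment> \<open>The successor makes \<open>m\<close> positive, since the rate function supplies
    no bound for \<open>m = 0\<close>.\<close>
  define m where "m = Suc M"
  have Gm: "x \<in> G" if "\<And>i. i < m \<Longrightarrow> \<bar>x i - z i\<bar> < e" for x
    using that by (intro e(2)[THEN spec, THEN mp]) (simp add: m_def)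
  obtain u w where uw: "\<And>i. i < m \<Longrightarrow> 0 \<le> u i \<and> u i < 1 \<and> 0 \<le> w i \<and> w i \<le> 1"
    "\<And>i. i < m \<Longrightarrow> stick_breaking w i = z i" "cost a b m u w < ereal r"
    using z[of m] unfolding Inf_less_iff by (auto simp: m_def)
  obtain u' w' where u'w': "\<And>i. 0 < u' i \<and> u' i < 1" "\<And>i. 0 < w' i \<and> w' i < 1"
    "(\<Sum>i<m. a * ln (1 / (1 - u' i)) + b * (\<Prod>j<i. 1 - u' j) * relative_entropy (u' i) (w' i)) < r"
    "\<And>i. i < m \<Longrightarrow> \<bar>stick_breaking w' i - stick_breaking w i\<bar> < e"
    using cost_interior_approximation[OF pos(4,5) uw(1) uw(3) e(1)] by blast
  have "open {y. \<forall>i<m. \<bar>stick_breaking y i - z i\<bar> < e}"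
    by (intro open_Collect_cylinder open_Collect_less continuous_intros continuous_on_stick_breaking_coordinate)
  moreover have "w' \<in> {y. \<forall>i<m. \<bar>stick_breaking y i - z i\<bar> < e}" using u'w'(4) uw(2) by auto
  ultimately have evw: "\<forall>\<^sub>F y in nhds w'. y \<in> {y. \<forall>i<m. \<bar>stick_breaking y i - z i\<bar> < e}"
    by (rule eventually_nhds_in_open)
  obtain d M' where d: "0 < d" "\<forall>y. (\<forall>i<M'. \<bar>y i - w' i\<bar> < d) \<longrightarrow>
      y \<in> {y. \<forall>i<m. \<bar>stick_breaking y i - z i\<bar> < e}"
    using eventually_nhds_cylinder[OF evw] by (elim exE conjE) (rule that)
  have sub: "{y. \<forall>i<m. y i \<in> {w' i - d<..<w' i + d}} \<subseteq> {y. stick_breaking y \<in> G}"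
  proof safe
    fix y assume y: "\<forall>i<m. y i \<in> {w' i - d<..<w' i + d}"
    let ?y = "\<lambda>i. if i < m then y i else w' i"
    have "?y \<in> {y. \<forall>i<m. \<bar>stick_breaking y i - z i\<bar> < e}"
      using y d(1) by (intro d(2)[THEN spec, THEN mp]) (auto simp: abs_if)
    moreover have "stick_breaking ?y i = stick_breaking y i" if "i < m" for i
      using that by (simp add: stick_breaking_def)
    ultimately show "stick_breaking y \<in> G" by (intro Gm) auto
  qed
  have "\<forall>\<^sub>F n in sequentially. ennreal (exp (- \<gamma> n * r)) \<le>
    (\<integral>\<^sup>+x. emeasure (W_kernel (\<beta> n) (stick_breaking x)) {y. \<forall>i<m. y i \<in> {w' i - d<..<w' i + d}} \<partial>U_law (\<alpha> n))"
    by (rule joint_box_lower_bound[OF u'w'(1,2) d(1) u'w'(3)])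
  then show ?thesis
  proof eventually_elim
    case (elim n)
    interpret prob_space "Q_law (\<alpha> n) (\<beta> n)" by (rule prob_space_Q_law)
    have "{y. stick_breaking y \<in> G} \<in> sets borel"
      using measurable_sets[OF stick_breaking_borel, of G] G(1) by (simp add: vimage_def)
    then have "(\<integral>\<^sup>+x. emeasure (W_kernel (\<beta> n) (stick_breaking x)) {y. \<forall>i<m. y i \<in> {w' i - d<..<w' i + d}} \<partial>U_law (\<alpha> n))
      \<le> (\<integral>\<^sup>+x. emeasure (W_kernel (\<beta> n) (stick_breaking x)) {y. stick_breaking y \<in> G} \<partial>U_law (\<alpha> n))"
      using sub by (intro nn_integral_mono emeasure_mono) auto
    also have "\<dots> = emeasure (Q_law (\<alpha> n) (\<beta> n)) (G \<inter> infinite_simplex)"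
      by (rule emeasure_Q_law[symmetric]) (use G in simp)
    finally have "ennreal (exp (- \<gamma> n * r)) \<le> emeasure (Q_law (\<alpha> n) (\<beta> n)) (G \<inter> infinite_simplex)"
      using elim by (rule order_trans[rotated])
    then show ?case by (simp add: emeasure_eq_measure)
  qed
qed

end

theorem theorem3p2:
  fixes c :: real and \<alpha> \<beta> :: "nat \<Rightarrow> real"
  assumes "0 < c"
    and "\<And>n. 0 < \<alpha> n" and "\<And>n. 0 < \<beta> n"
    and "filterlim \<alpha> at_top sequentially"
    and "filterlim \<beta> at_top sequentially"
    and "(\<lambda>n. \<alpha> n / \<beta> n) \<longlonglongrightarrow> c"
  shows "satisfies_LDP infinite_simplex sequentially
           (\<lambda>n. Q_law (\<alpha> n) (\<beta> n)) (\<lambda>n. max (\<alpha> n) (\<beta> n)) (rate c)"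
proof -
  define \<gamma> where "\<gamma> n = max (\<alpha> n) (\<beta> n)" for n
  have \<gamma>pos: "0 < \<gamma> n" for n using assms(2)[of n] by (simp add: \<gamma>_def less_max_iff_disj)
  have top: "filterlim \<gamma> at_top sequentially"
    by (rule filterlim_at_top_mono[OF assms(4)]) (simp add: \<gamma>_def)
  \<comment> \<open>Both ratios are continuous functions of \<open>\<alpha> n / \<beta> n\<close>,
    which gives the three cases for the coefficients at once.\<close>
  have \<gamma>_eq: "\<gamma> n = max (\<alpha> n / \<beta> n) 1 * \<beta> n" for n
    using assms(3)[of n] by (auto simp: \<gamma>_def max_def field_simps)
  have coeff: "coeff_a c = c / max c 1" "coeff_b c = 1 / max c 1"
    using assms(1) by (auto simp: coeff_a_def coeff_b_def max_def)
  have "(\<lambda>n. (\<alpha> n / \<beta> n) / max (\<alpha> n / \<beta> n) 1) \<longlonglongrightarrow> c / max c 1"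
    "(\<lambda>n. 1 / max (\<alpha> n / \<beta> n) 1) \<longlonglongrightarrow> 1 / max c 1"
    by (intro tendsto_intros assms(6); simp)+
  moreover have "(\<alpha> n / \<beta> n) / max (\<alpha> n / \<beta> n) 1 = \<alpha> n / \<gamma> n" "1 / max (\<alpha> n / \<beta> n) 1 = \<beta> n / \<gamma> n" for n
    using assms(3)[of n] unfolding \<gamma>_eq by simp_all
  ultimately have lim: "(\<lambda>n. \<alpha> n / \<gamma> n) \<longlonglongrightarrow> coeff_a c" "(\<lambda>n. \<beta> n / \<gamma> n) \<longlonglongrightarrow> coeff_b c"
    unfolding coeff by (simp_all only:)
  interpret scaled_parameters \<alpha> \<beta> \<gamma> "coeff_a c" "coeff_b c"
    by unfold_locales (use assms lim top \<gamma>pos in \<open>auto simp: coeff_a_def coeff_b_def\<close>)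
  have "satisfies_LDP infinite_simplex sequentially (\<lambda>n. Q_law (\<alpha> n) (\<beta> n)) \<gamma> (rate c)"
  proof (rule satisfies_LDP_local)
    fix z G r assume z: "open G" "z \<in> G" "rate c z < ereal r"
    have "rate_m c m z < ereal r \<or> m = 0" for m
    proof (cases "m = 0")
      case False
      then have "rate_m c m z \<le> rate c z" unfolding rate_def by (intro SUP_upper) simp
      then show ?thesis using z(3) by (meson order.strict_trans1)
    qed simp
    then show "\<forall>\<^sub>F n in sequentially. exp (- \<gamma> n * r) \<le> measure (Q_law (\<alpha> n) (\<beta> n)) (G \<inter> infinite_simplex)"
      unfolding rate_m_eq by (rule Q_law_local_lower_bound[OF z(1,2)])
  next
    fix z r assume "ereal r < rate c z"
    then obtain m where "ereal r < rate_m c m z" unfolding rate_def less_SUP_iff by blast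
    then show "\<exists>N C. open N \<and> z \<in> N \<and>
        (\<forall>\<^sub>F n in sequentially. measure (Q_law (\<alpha> n) (\<beta> n)) (N \<inter> infinite_simplex) \<le> C * exp (- \<gamma> n * r))"
      unfolding rate_m_eq by (rule Q_law_local_upper_bound) blast
  qed (use sets_Q_law space_Q_law prob_space_Q_law top compact_infinite_simplex in auto)
  then show ?thesis by (simp add: \<gamma>_def[abs_def])
qed

end
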